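(* Let $N$ be a compact connected one-dimensional manifold, i.e. a circle $S^1$ or a closed segment. For a $C^1$-generic map $f\in C^1(N,N)$ (that is, for all $f$ in some residual subset of $C^1(N,N)$ with the $C^1$-topology), each of the attractors $A_{Mil}(f)$ and $A_{gen}(f)$ either has empty interior or coincides with the whole phase space $N$.
   Context: $C^1(N,N)$ is the space of all $C^1$-maps (endomorphisms) of $N$ into itself. The Lebesgue measure on $N$ is any Borel probability measure equivalent to the Lebesgue measure in each coordinate chart. For a point $x$, $\omega(x)$ denotes the $\omega$-limit set of its forward orbit under $f$. The Milnor attractor $A_{Mil}(f)$ is the smallest (by inclusion) closed set that contains $\omega(x)$ for Lebesgue-almost every $x\in N$. The generic limit set $A_{gen}(f)$ is the smallest closed set that contains $\omega(x)$ for all $x$ in some residual subset of $N$. A residual subset of a space is a set containing a countable intersection of open dense subsets of that space. *)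

theory Defs
  imports "HOL-Probability.Probability"
begin

section \<open>Residual sets and limit sets\<close>

definition residual_in :: "'a topology \<Rightarrow> 'a set \<Rightarrow> bool" where
  "residual_in X R \<longleftrightarrow> R \<subseteq> topspace X \<and>
     (\<exists>\<U>. countable \<U> \<and> (\<forall>U\<in>\<U>. openin X U \<and> X closure_of U = topspace X) \<and>
          topspace X \<inter> \<Inter>\<U> \<subseteq> R)"

definition omega_limit :: "('a::topological_space \<Rightarrow> 'a) \<Rightarrow> 'a \<Rightarrow> 'a set" where
  "omega_limit f x = {y. \<exists>r::nat \<Rightarrow> nat. strict_mono r \<and> (\<lambda>n. (f ^^ r n) x) \<longlonglongrightarrow> y}"


section \<open>Attractors\<close>

text \<open>\<open>Least\<close> is taken with respect to inclusion of sets; the lemmas below show that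
  the least element exists when the phase space \<open>N\<close> is closed.\<close>

definition milnor_attractor ::
    "'a::topological_space set \<Rightarrow> 'a measure \<Rightarrow> ('a \<Rightarrow> 'a) \<Rightarrow> 'a set" where
  "milnor_attractor N \<mu> f =
     (LEAST A. closedin (top_of_set N) A \<and> (AE x in \<mu>. omega_limit f x \<subseteq> A))"

definition generic_limit_set ::
    "'a::topological_space set \<Rightarrow> ('a \<Rightarrow> 'a) \<Rightarrow> 'a set" where
  "generic_limit_set N f =
     (LEAST A. closedin (top_of_set N) A \<and>
        (\<exists>R. residual_in (top_of_set N) R \<and> (\<forall>x\<in>R. omega_limit f x \<subseteq> A)))"

lemma residual_in_topspace: "residual_in X (topspace X)"
  unfolding residual_in_def by (intro conjI exI[of _ "{}"]) auto

lemma residual_in_INT: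
  assumes "countable I" "I \<noteq> {}" "\<And>i. i \<in> I \<Longrightarrow> residual_in X (R i)"
  shows "residual_in X (\<Inter>i\<in>I. R i)"
proof -
  have "\<exists>\<U>. \<forall>i\<in>I. countable (\<U> i) \<and>
          (\<forall>U\<in>\<U> i. openin X U \<and> X closure_of U = topspace X) \<and> topspace X \<inter> \<Inter>(\<U> i) \<subseteq> R i"
    using assms(3) unfolding residual_in_def by (intro bchoice ballI) blast
  then obtain \<U> where \<U>: "\<And>i. i \<in> I \<Longrightarrow> countable (\<U> i)"
    "\<And>i U. i \<in> I \<Longrightarrow> U \<in> \<U> i \<Longrightarrow> openin X U \<and> X closure_of U = topspace X"
    "\<And>i. i \<in> I \<Longrightarrow> topspace X \<inter> \<Inter>(\<U> i) \<subseteq> R i"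
    by metis
  have "(\<Inter>i\<in>I. R i) \<subseteq> topspace X"
    using assms(2,3) unfolding residual_in_def by blast
  moreover have "countable (\<Union>i\<in>I. \<U> i)"
    using assms(1) \<U>(1) by blast
  moreover have "topspace X \<inter> \<Inter>(\<Union>i\<in>I. \<U> i) \<subseteq> (\<Inter>i\<in>I. R i)"
    using \<U>(3) by blast
  ultimately show ?thesis
    unfolding residual_in_def using \<U>(2) by (intro conjI exI[of _ "\<Union>i\<in>I. \<U> i"]) auto
qed

lemma least_closed:
  fixes N :: "'a::second_countable_topology set"
  assumes "closed N" and top: "P N"
    and INT: "\<And>\<A>. countable \<A> \<Longrightarrow> \<A> \<noteq> {} \<Longrightarrow> (\<forall>A\<in>\<A>. P A) \<Longrightarrow> P (\<Inter>\<A>)"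
  shows "closedin (top_of_set N) (LEAST A. closedin (top_of_set N) A \<and> P A)"
    and "P (LEAST A. closedin (top_of_set N) A \<and> P A)"
    and "\<And>B. closedin (top_of_set N) B \<Longrightarrow> P B \<Longrightarrow>
           (LEAST A. closedin (top_of_set N) A \<and> P A) \<subseteq> B"
proof -
  define \<F> where "\<F> = {A. closedin (top_of_set N) A \<and> P A}"
  have cl: "closed A" if "A \<in> \<F>" for A
    using that assms(1) closedin_closed_trans unfolding \<F>_def by blast
  have N: "N \<in> \<F>"
    unfolding \<F>_def using top by simp
  obtain \<G> where \<G>: "\<G> \<subseteq> uminus ` \<F>" "countable \<G>" "\<Union>\<G> = \<Union>(uminus ` \<F>)"
    using Lindelof[of "uminus ` \<F>"] cl by (metis (no_types, lifting) imageE open_Compl)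
  define \<H> where "\<H> = insert N (uminus ` \<G>)"
  have H: "countable \<H>" "\<H> \<noteq> {}" "\<H> \<subseteq> \<F>"
    unfolding \<H>_def using \<G>(1,2) N by auto
  have "\<Inter>\<H> \<subseteq> \<Inter>\<F>"
  proof
    fix x assume "x \<in> \<Inter>\<H>"
    then have "x \<notin> \<Union>\<G>"
      unfolding \<H>_def by auto
    then show "x \<in> \<Inter>\<F>"
      unfolding \<G>(3) by auto
  qed
  then have eq: "\<Inter>\<H> = \<Inter>\<F>"
    using H(3) by blast
  have 1: "closedin (top_of_set N) (\<Inter>\<F>)"
    using N by (intro closedin_Inter) (auto simp: \<F>_def)
  have 2: "P (\<Inter>\<F>)"
    using INT[OF H(1,2)] H(3) unfolding eq \<F>_def by blast
  have "(LEAST A. closedin (top_of_set N) A \<and> P A) = \<Inter>\<F>"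
    by (rule Least_equality) (use 1 2 in \<open>auto simp: \<F>_def\<close>)
  then show "closedin (top_of_set N) (LEAST A. closedin (top_of_set N) A \<and> P A)"
    "P (LEAST A. closedin (top_of_set N) A \<and> P A)"
    "\<And>B. closedin (top_of_set N) B \<Longrightarrow> P B \<Longrightarrow>
       (LEAST A. closedin (top_of_set N) A \<and> P A) \<subseteq> B"
    using 1 2 by (auto simp: \<F>_def)
qed

lemma omega_limit_subset:
  assumes "closed N" "f ` N \<subseteq> N" "x \<in> N"
  shows "omega_limit f x \<subseteq> N"
proof
  fix y assume "y \<in> omega_limit f x"
  then obtain r where "(\<lambda>n. (f ^^ r n) x) \<longlonglongrightarrow> y"
    unfolding omega_limit_def by blast
  moreover have "(f ^^ n) x \<in> N" for n
    by (induction n) (use assms in auto)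
  ultimately show "y \<in> N"
    using closed_sequentially[OF assms(1), of "\<lambda>n. (f ^^ r n) x" y] by simp
qed

lemma milnor_attractor_least:
  fixes N :: "'a::second_countable_topology set"
  assumes "closed N" "f ` N \<subseteq> N" "space \<mu> = N"
  shows "closedin (top_of_set N) (milnor_attractor N \<mu> f)"
    and "AE x in \<mu>. omega_limit f x \<subseteq> milnor_attractor N \<mu> f"
    and "\<And>B. closedin (top_of_set N) B \<Longrightarrow> AE x in \<mu>. omega_limit f x \<subseteq> B \<Longrightarrow>
           milnor_attractor N \<mu> f \<subseteq> B"
proof -
  let ?P = "\<lambda>A. AE x in \<mu>. omega_limit f x \<subseteq> A"
  have top: "?P N"
    using omega_limit_subset[OF assms(1,2)] assms(3) by auto
  have INT: "?P (\<Inter>\<A>)" if "countable \<A>" "\<A> \<noteq> {}" "\<forall>A\<in>\<A>. ?P A" for \<A>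
    using that AE_ball_countable[OF that(1), of "\<lambda>x A. omega_limit f x \<subseteq> A" \<mu>]
    by (simp add: le_Inf_iff)
  note L = least_closed[of N ?P, OF assms(1) top INT]
  show "closedin (top_of_set N) (milnor_attractor N \<mu> f)"
    "AE x in \<mu>. omega_limit f x \<subseteq> milnor_attractor N \<mu> f"
    "\<And>B. closedin (top_of_set N) B \<Longrightarrow> AE x in \<mu>. omega_limit f x \<subseteq> B \<Longrightarrow>
       milnor_attractor N \<mu> f \<subseteq> B"
    unfolding milnor_attractor_def using L by blast+
qed

lemma generic_limit_set_least:
  fixes N :: "'a::second_countable_topology set"
  assumes "closed N" "f ` N \<subseteq> N"
  shows "closedin (top_of_set N) (generic_limit_set N f)"
    and "\<exists>R. residual_in (top_of_set N) R \<and> (\<forall>x\<in>R. omega_limit f x \<subseteq> generic_limit_set N f)"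
    and "\<And>B R. closedin (top_of_set N) B \<Longrightarrow> residual_in (top_of_set N) R \<Longrightarrow>
           \<forall>x\<in>R. omega_limit f x \<subseteq> B \<Longrightarrow> generic_limit_set N f \<subseteq> B"
proof -
  let ?P = "\<lambda>A. \<exists>R. residual_in (top_of_set N) R \<and> (\<forall>x\<in>R. omega_limit f x \<subseteq> A)"
  have top: "?P N"
    using omega_limit_subset[OF assms] residual_in_topspace[of "top_of_set N"] by auto
  have INT: "?P (\<Inter>\<A>)" if \<A>: "countable \<A>" "\<A> \<noteq> {}" "\<forall>A\<in>\<A>. ?P A" for \<A>
  proof -
    obtain R where R: "\<forall>A\<in>\<A>. residual_in (top_of_set N) (R A) \<and> (\<forall>x\<in>R A. omega_limit f x \<subseteq> A)"
      using bchoice[OF \<A>(3)] by blast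
    have "residual_in (top_of_set N) (\<Inter>A\<in>\<A>. R A)"
      using R by (intro residual_in_INT \<A>(1,2)) blast
    moreover have "\<forall>x\<in>(\<Inter>A\<in>\<A>. R A). omega_limit f x \<subseteq> \<Inter>\<A>"
      using R by blast
    ultimately show ?thesis by blast
  qed
  note L = least_closed[of N ?P, OF assms(1) top INT]
  show "closedin (top_of_set N) (generic_limit_set N f)"
    "\<exists>R. residual_in (top_of_set N) R \<and> (\<forall>x\<in>R. omega_limit f x \<subseteq> generic_limit_set N f)"
    "\<And>B R. closedin (top_of_set N) B \<Longrightarrow> residual_in (top_of_set N) R \<Longrightarrow>
       \<forall>x\<in>R. omega_limit f x \<subseteq> B \<Longrightarrow> generic_limit_set N f \<subseteq> B"
    unfolding generic_limit_set_def using L by blast+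
qed


section \<open>\<open>C\<^sup>1\<close> endomorphisms of a parametrised one-dimensional manifold\<close>

text \<open>A one-dimensional manifold is given as \<open>N = \<gamma> ` I\<close> inside a Euclidean space, where
  \<open>\<gamma>\<close> restricts to smooth charts: \<open>N = sphere 0 1\<close>, \<open>\<gamma> = cis\<close>, \<open>I = UNIV\<close> for the circle and
  \<open>N = I = {a..b}\<close>, \<open>\<gamma> = id\<close> for a segment. A map \<open>f\<close> of \<open>N\<close> to itself is \<open>C\<^sup>1\<close> iff
  \<open>f \<circ> \<gamma>\<close> is \<open>C\<^sup>1\<close> as a map from \<open>I\<close> to the ambient space (one-sided derivatives at end points).
  Maps are normalised to be \<open>undefined\<close> off \<open>N\<close>, so that equality of functions is equality on \<open>N\<close>.\<close>

definition param_deriv ::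
    "(real \<Rightarrow> 'a::euclidean_space) \<Rightarrow> real set \<Rightarrow> ('a \<Rightarrow> 'a) \<Rightarrow> real \<Rightarrow> 'a" where
  "param_deriv \<gamma> I f t = vector_derivative (f \<circ> \<gamma>) (at t within I)"

definition C1_maps ::
    "'a::euclidean_space set \<Rightarrow> (real \<Rightarrow> 'a) \<Rightarrow> real set \<Rightarrow> ('a \<Rightarrow> 'a) set" where
  "C1_maps N \<gamma> I = {f \<in> N \<rightarrow>\<^sub>E N.
     (\<forall>t\<in>I. (f \<circ> \<gamma>) differentiable (at t within I)) \<and> continuous_on I (param_deriv \<gamma> I f)}"

definition C1_topology ::
    "'a::euclidean_space set \<Rightarrow> (real \<Rightarrow> 'a) \<Rightarrow> real set \<Rightarrow> ('a \<Rightarrow> 'a) topology" where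
  "C1_topology N \<gamma> I = topology (\<lambda>U. U \<subseteq> C1_maps N \<gamma> I \<and>
     (\<forall>f\<in>U. \<exists>e>0. \<forall>g\<in>C1_maps N \<gamma> I.
        (\<forall>x\<in>N. dist (f x) (g x) < e) \<and>
        (\<forall>t\<in>I. dist (param_deriv \<gamma> I f t) (param_deriv \<gamma> I g t) < e) \<longrightarrow> g \<in> U))"

lemma openin_C1_topology:
  "openin (C1_topology N \<gamma> I) U \<longleftrightarrow> U \<subseteq> C1_maps N \<gamma> I \<and>
     (\<forall>f\<in>U. \<exists>e>0. \<forall>g\<in>C1_maps N \<gamma> I.
        (\<forall>x\<in>N. dist (f x) (g x) < e) \<and>
        (\<forall>t\<in>I. dist (param_deriv \<gamma> I f t) (param_deriv \<gamma> I g t) < e) \<longrightarrow> g \<in> U)"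
proof -
  define near where "near e f g \<longleftrightarrow> (\<forall>x\<in>N. dist (f x) (g x) < e) \<and>
    (\<forall>t\<in>I. dist (param_deriv \<gamma> I f t) (param_deriv \<gamma> I g t) < e)" for e :: real and f g
  have mono: "near e' f g" if "near e f g" "e \<le> e'" for e e' f g
    using that unfolding near_def by force
  have "istopology (\<lambda>U. U \<subseteq> C1_maps N \<gamma> I \<and>
     (\<forall>f\<in>U. \<exists>e>0. \<forall>g\<in>C1_maps N \<gamma> I. near e f g \<longrightarrow> g \<in> U))" (is "istopology ?O")
    unfolding istopology_def
  proof (rule conjI; intro allI impI)
    fix S T assume S: "?O S" and T: "?O T"
    show "?O (S \<inter> T)"
    proof (intro conjI ballI)
      fix f assume "f \<in> S \<inter> T"
      then obtain e1 e2 where "e1 > 0" "e2 > 0"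
        "\<forall>g\<in>C1_maps N \<gamma> I. near e1 f g \<longrightarrow> g \<in> S" "\<forall>g\<in>C1_maps N \<gamma> I. near e2 f g \<longrightarrow> g \<in> T"
        using S T by blast
      then show "\<exists>e>0. \<forall>g\<in>C1_maps N \<gamma> I. near e f g \<longrightarrow> g \<in> S \<inter> T"
        using mono by (intro exI[of _ "min e1 e2"]) (meson IntI min.cobounded1 min.cobounded2 min_less_iff_conj)
    qed (use S in blast)
  next
    fix \<K> assume "\<forall>K\<in>\<K>. ?O K"
    then show "?O (\<Union>\<K>)"
      by (meson Sup_le_iff Union_iff)
  qed
  then show ?thesis
    unfolding C1_topology_def near_def by (simp add: topology_inverse')
qed

lemma topspace_C1_topology: "topspace (C1_topology N \<gamma> I) = C1_maps N \<gamma> I"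
proof
  show "topspace (C1_topology N \<gamma> I) \<subseteq> C1_maps N \<gamma> I"
    using openin_C1_topology openin_topspace by blast
  have "openin (C1_topology N \<gamma> I) (C1_maps N \<gamma> I)"
    unfolding openin_C1_topology by (auto intro: exI[of _ 1])
  then show "C1_maps N \<gamma> I \<subseteq> topspace (C1_topology N \<gamma> I)"
    by (rule openin_subset)
qed

text \<open>Equivalence with Lebesgue measure in the charts given by \<open>\<gamma>\<close>: the same Borel null sets.\<close>

definition lebesgue_type_measure ::
    "'a::euclidean_space set \<Rightarrow> (real \<Rightarrow> 'a) \<Rightarrow> real set \<Rightarrow> 'a measure \<Rightarrow> bool" where
  "lebesgue_type_measure N \<gamma> I \<mu> \<longleftrightarrow>
     prob_space \<mu> \<and> sets \<mu> = sets (restrict_space borel N) \<and>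
     (\<forall>B\<in>sets \<mu>. emeasure \<mu> B = 0 \<longleftrightarrow> emeasure lborel {t\<in>I. \<gamma> t \<in> B} = 0)"

end

theory Submission
  imports Defs
begin

text \<open>Suppose that an attractor \<open>A\<close> of \<open>f\<close> contains an arc \<open>J\<close>. As \<open>A\<close> is the least closed set
  capturing the limit sets in question, every subarc of \<open>J\<close> is visited infinitely often by some
  orbit. Let \<open>E\<close> be the union of the forward images of \<open>J\<close>; it is contained in \<open>A\<close>. If \<open>E \<noteq> N\<close>,
  then \<open>f\<close> is a \<open>C\<^sup>1\<close>-limit of maps for which part of \<open>J\<close> falls into the basin of a sink and never
  returns, a property that is open and excludes \<open>J \<subseteq> A\<close>. Maps that are neither interior points nor
  exterior points of this open set form a nowhere dense set, for each of the countably many arcs \<open>J\<close>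
  with rational end points, and these are discarded. To find the sink:

  \<^item> If some iterate of \<open>f\<close> has a critical point on \<open>J\<close>, then the orbit of \<open>J\<close> reaches a critical
    point \<open>c\<close> of \<open>f\<close>. An orbit goes from the \<open>\<delta>\<close>-neighbourhood of \<open>c\<close> back into its
    \<open>\<delta>/2\<close>-neighbourhood; making \<open>f\<close> constant on the latter, with the value taken at the last preceding
    visit to the former, closes this orbit into a superattracting cycle. The perturbation is
    \<open>C\<^sup>1\<close>-small because \<open>f\<close> oscillates by \<open>o(\<delta>)\<close> there.
  \<^item> Otherwise some iterate of \<open>f\<close> acts on an arc containing \<open>J\<close> as an increasing map, and recurrence
    forces it to be the identity on \<open>J\<close>. Pulling \<open>f\<close> slightly towards its value at a point of maximal
    period gives a sink.\<close>

section \<open>Preliminaries\<close>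

definition C1_near ::
    "'a::euclidean_space set \<Rightarrow> (real \<Rightarrow> 'a) \<Rightarrow> real set \<Rightarrow> real \<Rightarrow> ('a \<Rightarrow> 'a) \<Rightarrow> ('a \<Rightarrow> 'a) \<Rightarrow> bool" where
  "C1_near N \<gamma> I e f g \<longleftrightarrow> (\<forall>x\<in>N. dist (f x) (g x) < e) \<and>
     (\<forall>t\<in>I. dist (param_deriv \<gamma> I f t) (param_deriv \<gamma> I g t) < e)"

lemma C1_near_triangle:
  assumes "C1_near N \<gamma> I a f g" "C1_near N \<gamma> I b g h"
  shows "C1_near N \<gamma> I (a + b) f h"
  using assms unfolding C1_near_def by (meson add_strict_mono dist_triangle le_less_trans)

lemma openin_C1_topology_near:
  "openin (C1_topology N \<gamma> I) U \<longleftrightarrow> U \<subseteq> C1_maps N \<gamma> I \<and>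
     (\<forall>f\<in>U. \<exists>e>0. \<forall>g\<in>C1_maps N \<gamma> I. C1_near N \<gamma> I e f g \<longrightarrow> g \<in> U)"
  unfolding openin_C1_topology C1_near_def ..

text \<open>Only the boundary of \<open>V\<close> is missed, and the boundary of an open set is
  nowhere dense. Intersecting these dense open sets over countably many \<open>V\<close> will give
  the residual set.\<close>

lemma openin_Un_exterior:
  assumes "openin X V"
  shows "openin X (V \<union> (topspace X - X closure_of V))"
    and "X closure_of (V \<union> (topspace X - X closure_of V)) = topspace X"
proof -
  show "openin X (V \<union> (topspace X - X closure_of V))"
    using assms by (intro openin_Un openin_diff) auto
  have "topspace X - X closure_of V \<subseteq> X closure_of (topspace X - X closure_of V)"
    by (simp add: closure_of_subset)
  then show "X closure_of (V \<union> (topspace X - X closure_of V)) = topspace X"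
    using closure_of_subset_topspace[of X] by (auto simp: closure_of_Un)
qed

text \<open>The step compares \<open>f\<close> at the two \<open>n\<close>-th iterates by uniform
  continuity of \<open>f\<close>, then \<open>f\<close> with \<open>g\<close> at the iterate of
  \<open>g\<close>. The modulus of continuity is that of \<open>f\<close>, so one \<open>d\<close>
  serves all \<open>g\<close>.\<close>

lemma iterates_near:
  fixes f :: "'a::metric_space \<Rightarrow> 'a"
  assumes "compact N" "continuous_on N f" "f \<in> N \<rightarrow> N" "0 < e"
  shows "\<exists>d>0. \<forall>g\<in>N \<rightarrow> N. (\<forall>x\<in>N. dist (f x) (g x) < d) \<longrightarrow>
           (\<forall>x\<in>N. dist ((f ^^ n) x) ((g ^^ n) x) < e)"
  using assms(4)
proof (induction n arbitrary: e)
  case 0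
  then show ?case by (intro exI[of _ 1]) auto
next
  case (Suc n)
  have "uniformly_continuous_on N f"
    by (rule compact_uniformly_continuous[OF assms(2,1)])
  then obtain d1 where d1: "d1 > 0" "\<And>x y. x \<in> N \<Longrightarrow> y \<in> N \<Longrightarrow> dist y x < d1 \<Longrightarrow> dist (f y) (f x) < e / 2"
    using Suc.prems unfolding uniformly_continuous_on_def by (metis half_gt_zero)
  obtain d2 where d2: "d2 > 0" "\<forall>g\<in>N \<rightarrow> N. (\<forall>x\<in>N. dist (f x) (g x) < d2) \<longrightarrow>
           (\<forall>x\<in>N. dist ((f ^^ n) x) ((g ^^ n) x) < d1)"
    using Suc.IH[OF d1(1)] by blast
  show ?case
  proof (intro exI[of _ "min d2 (e / 2)"] conjI ballI impI)
    fix g x assume g: "g \<in> N \<rightarrow> N" "\<forall>x\<in>N. dist (f x) (g x) < min d2 (e / 2)" and x: "x \<in> N"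
    have inN: "(h ^^ n) x \<in> N" if "h \<in> N \<rightarrow> N" for h
      by (induction n) (use that x in auto)
    have "dist ((f ^^ n) x) ((g ^^ n) x) < d1"
      using d2 g x by simp
    then have "dist (f ((f ^^ n) x)) (f ((g ^^ n) x)) < e / 2"
      using d1(2) inN g(1) assms(3) by blast
    moreover have "dist (f ((g ^^ n) x)) (g ((g ^^ n) x)) < e / 2"
      using g inN by auto
    ultimately have "dist (f ((f ^^ n) x)) (g ((g ^^ n) x)) < e"
      using dist_triangle_half_r by (metis dist_commute)
    then show "dist ((f ^^ Suc n) x) ((g ^^ Suc n) x) < e" by simp
  qed (use d2 Suc.prems in auto)
qed

text \<open>Pigeonhole on residues modulo \<open>p\<close>. It turns infinitely many visits to a set
  into a return whose time is a multiple of a prescribed number.\<close>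

lemma infinite_nat_congruent_pair:
  assumes "infinite (S::nat set)" "0 < p"
  shows "\<exists>m j. m \<in> S \<and> m + p * j \<in> S \<and> 0 < j"
proof -
  have "\<not> inj_on (\<lambda>n. n mod p) S"
  proof
    assume "inj_on (\<lambda>n. n mod p) S"
    moreover have "(\<lambda>n. n mod p) ` S \<subseteq> {..<p}" using assms(2) by auto
    ultimately show False using assms(1) finite_imageD finite_subset by blast
  qed
  then obtain x y where "x \<in> S" "y \<in> S" "x mod p = y mod p" "x < y"
    unfolding inj_on_def by (metis linorder_neqE_nat)
  moreover then obtain j where "y = x + p * j"
    by (metis mod_eq_dvd_iff_nat less_imp_le dvd_def le_add_diff_inverse)
  ultimately show ?thesis by (intro exI[of _ x] exI[of _ j]) (auto intro: ccontr)
qed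

section \<open>A C1 bump function with controlled slope\<close>

lemma max_square_DERIV:
  "((\<lambda>y::real. (max 0 y)\<^sup>2) has_real_derivative 2 * max 0 y) (at y)"
proof -
  consider "y > 0" | "y < 0" | "y = 0" by linarith
  then show ?thesis
  proof cases
    case 1
    have "((\<lambda>y::real. y\<^sup>2) has_real_derivative 2 * y) (at y)"
      by (auto intro!: derivative_eq_intros)
    then show ?thesis
      using 1 by (subst DERIV_cong_ev[where g = "\<lambda>y. y\<^sup>2" and v = "2 * y" and y = y])
        (auto intro: eventually_mono[OF eventually_nhds_in_open[of "{0<..}"]])
  next
    case 2
    then show ?thesis
      by (subst DERIV_cong_ev[where g = "\<lambda>y. 0" and v = 0 and y = y])
        (auto intro: eventually_mono[OF eventually_nhds_in_open[of "{..<0}"]])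
  next
    case 3
    have "((\<lambda>h::real. (max 0 h)\<^sup>2 / h) \<longlongrightarrow> 0) (at 0)"
    proof (rule Lim_null_comparison[where g = "\<lambda>h. \<bar>h\<bar>"])
      show "\<forall>\<^sub>F h::real in at 0. norm ((max 0 h)\<^sup>2 / h) \<le> \<bar>h\<bar>"
        by (auto simp: max_def power2_eq_square)
    qed (rule tendsto_eq_intros; simp)+
    then show ?thesis unfolding 3 DERIV_def by simp
  qed
qed

text \<open>The slope is of order \<open>1 / \<delta>\<close>, with a constant independent of the
  centre. Multiplied by a function that is small compared with \<open>\<delta>\<close>, the bump
  still gives a C1-small perturbation.\<close>

lemma C1_bump:
  fixes \<tau> \<delta> :: real
  assumes "0 < \<delta>"
  shows "\<exists>\<phi> \<phi>'. (\<forall>t. (\<phi> has_real_derivative \<phi>' t) (at t)) \<and> continuous_on UNIV \<phi>' \<and>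
    (\<forall>t. 0 \<le> \<phi> t \<and> \<phi> t \<le> 1 \<and> \<bar>\<phi>' t\<bar> \<le> 11 / \<delta>) \<and>
    (\<forall>t. \<bar>t - \<tau>\<bar> \<le> \<delta> / 2 \<longrightarrow> \<phi> t = 1) \<and> (\<forall>t. \<delta> \<le> \<bar>t - \<tau>\<bar> \<longrightarrow> \<phi> t = 0 \<and> \<phi>' t = 0)"
proof -
  \<comment> \<open>\<open>y t\<close> is at least 1 exactly for
    \<open>\<bar>t - \<tau>\<bar> \<le> \<delta> / 2\<close> and at most 0 exactly for
    \<open>\<delta> \<le> \<bar>t - \<tau>\<bar>\<close>. Squares of positive parts cut it off at
    these two levels in a C1 way. The slope is \<open>4 * b t * a t * y' t\<close>, of modulus at
    most \<open>32 / (3 * \<delta>)\<close>, which is rounded up to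
    \<open>11 / \<delta>\<close>.\<close>
  define y where "y t = 4 / 3 * (1 - ((t - \<tau>) / \<delta>)\<^sup>2)" for t
  define y' where "y' t = - (8 / 3 * ((t - \<tau>) / \<delta>) / \<delta>)" for t
  define a where "a t = max 0 (y t)" for t
  define b where "b t = max 0 (1 - (a t)\<^sup>2)" for t
  have dy: "(y has_real_derivative y' t) (at t)" for t
    unfolding y_def y'_def using assms
    by (auto intro!: derivative_eq_intros simp: field_simps power2_eq_square)
  have da: "((\<lambda>t. (a t)\<^sup>2) has_real_derivative 2 * a t * y' t) (at t)" for t
    unfolding a_def by (rule DERIV_chain2[OF max_square_DERIV dy])
  have db: "((\<lambda>t. (b t)\<^sup>2) has_real_derivative 2 * b t * (0 - 2 * a t * y' t)) (at t)" for t
    unfolding b_def by (rule DERIV_chain2[OF max_square_DERIV]) (intro DERIV_diff DERIV_const da)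
  define \<phi> where "\<phi> t = 1 - (b t)\<^sup>2" for t
  define \<phi>' where "\<phi>' t = 4 * b t * a t * y' t" for t
  have "(\<phi> has_real_derivative (0 - 2 * b t * (0 - 2 * a t * y' t))) (at t)" for t
    unfolding \<phi>_def by (intro DERIV_diff DERIV_const db)
  then have 1: "(\<phi> has_real_derivative \<phi>' t) (at t)" for t
    by (simp add: \<phi>'_def mult.assoc)
  have 2: "continuous_on UNIV \<phi>'"
    unfolding \<phi>'_def b_def a_def y_def y'_def using assms by (intro continuous_intros) auto
  have b01: "0 \<le> b t" "b t \<le> 1" for t unfolding b_def by auto
  have sq: "((t - \<tau>) / \<delta>)\<^sup>2 \<le> 1 / 4" if "\<bar>t - \<tau>\<bar> \<le> \<delta> / 2" for t
  proof -
    have "\<bar>(t - \<tau>) / \<delta>\<bar> \<le> 1 / 2" using that assms by (simp add: field_simps)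
    then have "\<bar>(t - \<tau>) / \<delta>\<bar>\<^sup>2 \<le> (1 / 2)\<^sup>2" by (intro power_mono) auto
    then show ?thesis by (simp add: power2_eq_square)
  qed
  have one: "\<phi> t = 1" if "\<bar>t - \<tau>\<bar> \<le> \<delta> / 2" for t
  proof -
    have "1 \<le> y t" using sq[OF that] unfolding y_def by simp
    then have "1 \<le> (a t)\<^sup>2" unfolding a_def by (simp add: one_le_power)
    then show ?thesis unfolding \<phi>_def b_def by simp
  qed
  have zero: "a t = 0" if "\<delta> \<le> \<bar>t - \<tau>\<bar>" for t
  proof -
    have "1 \<le> \<bar>(t - \<tau>) / \<delta>\<bar>" using that assms by (simp add: field_simps)
    then have "1 \<le> ((t - \<tau>) / \<delta>)\<^sup>2" using one_le_power[of "\<bar>(t - \<tau>) / \<delta>\<bar>" 2]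
      by (simp only: power2_abs)
    then show ?thesis unfolding a_def y_def by simp
  qed
  have bd: "\<bar>\<phi>' t\<bar> \<le> 11 / \<delta>" for t
  proof (cases "\<delta> \<le> \<bar>t - \<tau>\<bar>")
    case True
    then show ?thesis using zero assms by (simp add: \<phi>'_def)
  next
    case False
    have "b t * a t \<le> 1"
    proof (cases "a t \<le> 1")
      case True
      then show ?thesis using b01[of t] by (simp add: a_def mult_le_one)
    next
      case False
      then have "1 \<le> (a t)\<^sup>2" by (simp add: one_le_power)
      then have "b t = 0" unfolding b_def by simp
      then show ?thesis by simp
    qed
    moreover have "0 \<le> b t * a t" using b01[of t] by (simp add: a_def)
    ultimately have "\<bar>b t * a t\<bar> \<le> 1" by linarith
    moreover have "\<bar>y' t\<bar> \<le> (8 / 3) / \<delta>"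
      using False assms unfolding y'_def by (simp add: abs_mult field_simps)
    ultimately have "\<bar>b t * a t\<bar> * \<bar>y' t\<bar> \<le> 1 * ((8 / 3) / \<delta>)"
      by (intro mult_mono) auto
    then have "\<bar>\<phi>' t\<bar> \<le> 4 * ((8 / 3) / \<delta>)"
      by (simp add: \<phi>'_def abs_mult)
    also have "\<dots> \<le> 11 / \<delta>" using assms by (simp add: field_simps)
    finally show ?thesis .
  qed
  have "0 \<le> \<phi> t \<and> \<phi> t \<le> 1" for t
    using b01[of t] power_le_one[of "b t" 2] by (simp add: \<phi>_def)
  moreover have "\<phi> t = 0 \<and> \<phi>' t = 0" if "\<delta> \<le> \<bar>t - \<tau>\<bar>" for t
    using zero[OF that] by (simp add: \<phi>_def \<phi>'_def b_def)
  ultimately show ?thesis using 1 2 one bd by (intro exI[of _ \<phi>] exI[of _ \<phi>']) blast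
qed

lemma ne_emptyI: "x \<in> A \<Longrightarrow> A \<noteq> {}" by blast

text \<open>A monotone map never brings a point that it moves up back below its first image. This
  and its mirror image exclude recurrence near a point that is not fixed.\<close>

lemma iterate_monotone_above:
  fixes H :: "real \<Rightarrow> real"
  assumes "\<And>x. x \<in> K \<Longrightarrow> H x \<in> K" "\<And>x y. x \<in> K \<Longrightarrow> y \<in> K \<Longrightarrow> x \<le> y \<Longrightarrow> H x \<le> H y"
    and "x \<in> K" "x \<le> H x"
  shows "H x \<le> (H ^^ Suc j) x"
proof (induction j)
  case (Suc j)
  have "(H ^^ i) x \<in> K" for i by (induction i) (use assms in auto)
  then have "H x \<le> H ((H ^^ Suc j) x)"
    using assms(2)[of x "(H ^^ Suc j) x"] assms(3,4) Suc by (meson order_trans)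
  then show ?case by simp
qed simp

lemma iterate_monotone_below:
  fixes H :: "real \<Rightarrow> real"
  assumes "\<And>x. x \<in> K \<Longrightarrow> H x \<in> K" "\<And>x y. x \<in> K \<Longrightarrow> y \<in> K \<Longrightarrow> x \<le> y \<Longrightarrow> H x \<le> H y"
    and "x \<in> K" "H x \<le> x"
  shows "(H ^^ Suc j) x \<le> H x"
proof (induction j)
  case (Suc j)
  have "(H ^^ i) x \<in> K" for i by (induction i) (use assms in auto)
  then have "H ((H ^^ Suc j) x) \<le> H x"
    using assms(2)[of "(H ^^ Suc j) x" x] assms(3,4) Suc by (meson order_trans)
  then show ?case by simp
qed simp


section \<open>Recurrence and traps on a parametrised curve\<close>

text \<open>What the circle and the segment have in common. \<open>deck\<close> supplies the
  translations relating parameters of the same point: multiples of 2 pi on the circle, 0 on the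
  segment. \<open>inj_connected\<close> says that a connected parameter set can wrap around only by
  covering the whole curve, and \<open>w\<close> is a length below which \<open>\<gamma>\<close> is
  injective.\<close>

locale parametrised_curve =
  fixes N :: "'a::euclidean_space set" and \<gamma> :: "real \<Rightarrow> 'a" and I :: "real set" and w :: real
  assumes compact_N: "compact N" and closed_I: "closed I" and convex_I: "convex I"
    and interior_dense: "I \<subseteq> closure (interior I)"
    and image_eq: "\<gamma> ` I = N"
    and continuous_param: "continuous_on I \<gamma>"
    and open_param: "\<And>S. openin (top_of_set I) S \<Longrightarrow> openin (top_of_set N) (\<gamma> ` S)"
    and w_pos: "0 < w"
    and inj_short: "\<And>s t. s \<in> I \<Longrightarrow> t \<in> I \<Longrightarrow> \<bar>s - t\<bar> < w \<Longrightarrow> \<gamma> s = \<gamma> t \<Longrightarrow> s = t"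
    and deck: "\<And>s t. s \<in> I \<Longrightarrow> t \<in> I \<Longrightarrow> \<gamma> s = \<gamma> t \<Longrightarrow>
                 \<exists>c. s + c = t \<and> (\<forall>x\<in>I. x + c \<in> I \<and> \<gamma> (x + c) = \<gamma> x)"
    and inj_connected: "\<And>K. K \<subseteq> I \<Longrightarrow> connected K \<Longrightarrow> \<gamma> ` K \<noteq> N \<Longrightarrow> inj_on \<gamma> K"
begin

abbreviation "C1 \<equiv> C1_maps N \<gamma> I"
abbreviation "near \<equiv> C1_near N \<gamma> I"

text \<open>The last conjunct makes \<open>F'\<close> a function of the point
  \<open>\<gamma> t\<close>: whether an orbit meets a critical point does not depend on the
  parameters chosen to represent it.\<close>

definition lift :: "('a \<Rightarrow> 'a) \<Rightarrow> (real \<Rightarrow> real) \<Rightarrow> (real \<Rightarrow> real) \<Rightarrow> bool" where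
  "lift f F F' \<longleftrightarrow> (\<forall>t\<in>I. F t \<in> I \<and> f (\<gamma> t) = \<gamma> (F t) \<and>
       (F has_real_derivative F' t) (at t within I)) \<and>
     continuous_on I F' \<and> (\<forall>s\<in>I. \<forall>t\<in>I. \<gamma> s = \<gamma> t \<longrightarrow> F' s = F' t)"

definition recurs :: "('a \<Rightarrow> 'a) \<Rightarrow> 'a set \<Rightarrow> bool" where
  "recurs f S \<longleftrightarrow> (\<exists>z\<in>N. infinite {n. (f ^^ n) z \<in> S})"

text \<open>Each subarc may be visited by an orbit of its own, which is what minimality of an
  attractor yields directly.\<close>

definition everywhere_recurrent :: "real \<Rightarrow> real \<Rightarrow> ('a \<Rightarrow> 'a) set" where
  "everywhere_recurrent p q =
     {f \<in> C1. \<forall>r s. p \<le> r \<longrightarrow> r < s \<longrightarrow> s \<le> q \<longrightarrow> recurs f (\<gamma> ` {r<..<s})}"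

text \<open>\<open>C\<close> is a trapping region for the \<open>P\<close>-th iterate. The arc
  contains a point \<open>x\<close> that enters \<open>U\<close> after \<open>m\<close> steps but
  lies outside \<open>C\<close> and its first \<open>P - 1\<close> images. The clauses place compact
  sets inside open ones, which makes the property stable.\<close>

definition traps :: "('a \<Rightarrow> 'a) \<Rightarrow> real \<Rightarrow> real \<Rightarrow> bool" where
  "traps g p q \<longleftrightarrow> (\<exists>C U P m x. 0 < P \<and> compact C \<and> C \<subseteq> N \<and> U \<subseteq> C \<and> openin (top_of_set N) U \<and>
     (g ^^ P) ` C \<subseteq> U \<and> (g ^^ m) x \<in> U \<and> x \<in> \<gamma> ` {p<..<q} \<and> (\<forall>i<P. x \<notin> (g ^^ i) ` C))"

lemma C1_into: "f \<in> C1 \<Longrightarrow> f \<in> N \<rightarrow> N"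
  unfolding C1_maps_def by (auto simp: PiE_def)

lemma iterate_in: "f \<in> C1 \<Longrightarrow> x \<in> N \<Longrightarrow> (f ^^ n) x \<in> N"
  using C1_into by (induction n) auto

lemma param_in: "t \<in> I \<Longrightarrow> \<gamma> t \<in> N"
  using image_eq by blast

section \<open>Lifts of iterates and continuity in the parameter\<close>

lemma lift_into: "lift f F F' \<Longrightarrow> t \<in> I \<Longrightarrow> F t \<in> I"
  and lift_eq: "lift f F F' \<Longrightarrow> t \<in> I \<Longrightarrow> f (\<gamma> t) = \<gamma> (F t)"
  and lift_DERIV: "lift f F F' \<Longrightarrow> t \<in> I \<Longrightarrow> (F has_real_derivative F' t) (at t within I)"
  and lift_continuous_deriv: "lift f F F' \<Longrightarrow> continuous_on I F'"
  and lift_deriv_eq: "lift f F F' \<Longrightarrow> s \<in> I \<Longrightarrow> t \<in> I \<Longrightarrow> \<gamma> s = \<gamma> t \<Longrightarrow> F' s = F' t"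
  unfolding lift_def by blast+

lemma lift_continuous: "lift f F F' \<Longrightarrow> continuous_on I F"
  using lift_DERIV DERIV_continuous continuous_on_eq_continuous_within by blast

lemma lift_iterate:
  assumes "lift f F F'" "t \<in> I"
  shows "(F ^^ n) t \<in> I" "(f ^^ n) (\<gamma> t) = \<gamma> ((F ^^ n) t)"
    "((F ^^ n) has_real_derivative (\<Prod>i<n. F' ((F ^^ i) t))) (at t within I)"
proof -
  have 1: "(F ^^ n) t \<in> I" if "t \<in> I" for t n
    using that lift_into[OF assms(1)] by (induction n) auto
  show "(F ^^ n) t \<in> I" using 1 assms(2) .
  show "(f ^^ n) (\<gamma> t) = \<gamma> ((F ^^ n) t)"
    using lift_eq[OF assms(1)] 1[OF assms(2)] by (induction n) auto
  show "((F ^^ n) has_real_derivative (\<Prod>i<n. F' ((F ^^ i) t))) (at t within I)"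
  proof (induction n)
    case 0
    then show ?case by (simp add: id_def)
  next
    case (Suc n)
    have "(F has_real_derivative F' ((F ^^ n) t)) (at ((F ^^ n) t) within (F ^^ n) ` I)"
      by (rule has_field_derivative_subset[OF lift_DERIV[OF assms(1)]]) (use 1 assms(2) in auto)
    from DERIV_image_chain[OF this Suc.IH] show ?case
      by (simp add: mult.commute o_def)
  qed
qed

lemma lift_iterate_continuous:
  assumes "lift f F F'"
  shows "continuous_on I (F ^^ n)" "continuous_on I (\<lambda>t. \<Prod>i<n. F' ((F ^^ i) t))"
proof -
  have 1: "continuous_on I (F ^^ n)" for n
    using lift_iterate(3)[OF assms] DERIV_continuous continuous_on_eq_continuous_within by blast
  then show "continuous_on I (F ^^ n)" .
  show "continuous_on I (\<lambda>t. \<Prod>i<n. F' ((F ^^ i) t))"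
    using lift_iterate(1)[OF assms]
    by (intro continuous_on_prod continuous_on_compose2[OF lift_continuous_deriv[OF assms] 1]) auto
qed

text \<open>Regularity is known only for \<open>f \<circ> \<gamma>\<close>. As
  \<open>\<gamma>\<close> is open onto \<open>N\<close>, preimages under \<open>f\<close> are open
  because their preimages in the parameter are.\<close>

lemma C1_continuous:
  assumes "f \<in> C1"
  shows "continuous_on N f"
proof -
  have "continuous_on I (f \<circ> \<gamma>)"
    using assms differentiable_imp_continuous_within
    unfolding C1_maps_def continuous_on_eq_continuous_within by blast
  moreover have "N \<inter> f -` B = \<gamma> ` (I \<inter> (f \<circ> \<gamma>) -` B)" for B
    using image_eq by auto
  ultimately show ?thesis
    unfolding continuous_openin_preimage_eq using open_param by metis
qed

lemma iterate_continuous: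
  assumes "f \<in> C1"
  shows "continuous_on N (f ^^ n)"
proof (induction n)
  case (Suc n)
  have "continuous_on N (f \<circ> (f ^^ n))"
    using iterate_in[OF assms]
    by (intro continuous_on_compose Suc continuous_on_subset[OF C1_continuous[OF assms]]) auto
  then show ?case by simp
qed (simp add: id_def)

lemma eventually_iterate:
  assumes "f \<in> C1" "x \<in> N" "openin (top_of_set N) T" "(f ^^ i) x \<in> T"
  shows "\<forall>\<^sub>F y in nhds x. y \<in> N \<longrightarrow> (f ^^ i) y \<in> T"
proof -
  have "openin (top_of_set N) (N \<inter> (f ^^ i) -` T)"
    using continuous_openin_preimage[OF iterate_continuous[OF assms(1)] _ assms(3)] iterate_in[OF assms(1)]
    by blast
  then obtain S where "open S" "N \<inter> (f ^^ i) -` T = N \<inter> S"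
    by (metis openin_open)
  moreover from this have "x \<in> S" using assms(2,4) by blast
  ultimately show ?thesis
    using eventually_nhds_in_open[of S x] by (blast intro: eventually_mono)
qed

lemma eventually_iterate_param:
  assumes "f \<in> C1" "t \<in> interior I" "openin (top_of_set N) T" "(f ^^ i) (\<gamma> t) \<in> T"
  shows "\<forall>\<^sub>F s in nhds t. (f ^^ i) (\<gamma> s) \<in> T"
proof -
  have t: "t \<in> I" using assms(2) interior_subset by blast
  have "filterlim \<gamma> (nhds (\<gamma> t)) (nhds t)"
    using continuous_on_interior[OF continuous_param assms(2)] by (simp add: tendsto_at_iff_tendsto_nhds isCont_def)
  from eventually_compose_filterlim[OF eventually_iterate[OF assms(1) param_in[OF t] assms(3,4)] this]
  have "\<forall>\<^sub>F s in nhds t. \<gamma> s \<in> N \<longrightarrow> (f ^^ i) (\<gamma> s) \<in> T" .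
  moreover have "\<forall>\<^sub>F s in nhds t. s \<in> I"
    using eventually_nhds_in_open[of "interior I" t] assms(2) interior_subset
    by (auto elim!: eventually_mono)
  ultimately show ?thesis
    by eventually_elim (use param_in in auto)
qed

lemma closed_param_cball: "closed (\<gamma> ` (I \<inter> cball \<tau> r))"
  by (intro compact_imp_closed compact_continuous_image continuous_on_subset[OF continuous_param])
    (auto simp: closed_Int_compact[OF closed_I])

lemma openin_param: "open S \<Longrightarrow> openin (top_of_set N) (\<gamma> ` (I \<inter> S))"
  by (intro open_param openin_open_Int)

lemma interval_interior: "{p<..<q} \<subseteq> I \<Longrightarrow> {p<..<q::real} \<subseteq> interior I"
  by (simp add: interior_maximal)

lemma openin_diff_closed: "closed S \<Longrightarrow> openin (top_of_set N) (N - S)"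
  by (metis Diff_eq openin_open_Int open_Compl)

text \<open>A small arc around \<open>x\<close> falls into \<open>U\<close> after \<open>m\<close>
  steps and is disjoint from \<open>C\<close> and its first \<open>P - 1\<close> images. An orbit
  that visits this arc is confined to those sets from \<open>m\<close> steps later on, so it makes
  only finitely many visits.\<close>

lemma traps_not_everywhere_recurrent:
  assumes "f \<in> C1" "traps f p q" "{p<..<q} \<subseteq> I"
  shows "f \<notin> everywhere_recurrent p q"
proof
  assume rec: "f \<in> everywhere_recurrent p q"
  obtain C U P m x where *: "0 < P" "compact C" "C \<subseteq> N" "U \<subseteq> C" "openin (top_of_set N) U"
     "(f ^^ P) ` C \<subseteq> U" "(f ^^ m) x \<in> U" "x \<in> \<gamma> ` {p<..<q}" "\<And>i. i < P \<Longrightarrow> x \<notin> (f ^^ i) ` C"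
    using assms(2) unfolding traps_def by blast
  obtain t where t: "t \<in> {p<..<q}" "x = \<gamma> t" using *(8) by blast
  have tI: "t \<in> interior I" using t(1) interval_interior[OF assms(3)] by blast
  have xN: "x \<in> N" using t assms(3) param_in by blast
  have cl: "openin (top_of_set N) (N - (f ^^ i) ` C)" for i
    using compact_continuous_image[OF continuous_on_subset[OF iterate_continuous[OF assms(1)] *(3)] *(2)]
    by (intro openin_diff_closed compact_imp_closed)
  \<comment> \<open>The exponent 0 lets the continuity lemma for iterates also treat the condition
    on \<open>\<gamma> s\<close> itself.\<close>
  have "\<forall>\<^sub>F s in nhds t. s \<in> {p<..<q} \<and> (f ^^ m) (\<gamma> s) \<in> U \<and> (\<forall>i\<in>{..<P}. (f ^^ 0) (\<gamma> s) \<in> N - (f ^^ i) ` C)"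
    using t *(7) *(9) xN
    by (intro eventually_conj eventually_ball_finite ballI eventually_iterate_param[OF assms(1) tI]
        eventually_nhds_in_open cl *(5)) auto
  then obtain d where d: "d > 0" "\<And>s. dist s t < d \<Longrightarrow> s \<in> {p<..<q}"
      "\<And>s. dist s t < d \<Longrightarrow> (f ^^ m) (\<gamma> s) \<in> U"
      "\<And>s i. dist s t < d \<Longrightarrow> i < P \<Longrightarrow> \<gamma> s \<notin> (f ^^ i) ` C"
    unfolding eventually_nhds_metric by fastforce
  have "p \<le> t - d / 2" "t + d / 2 \<le> q"
    using d(1) d(2)[of "t - d / 2"] d(2)[of "t + d / 2"] by (auto simp: dist_real_def)
  then have "recurs f (\<gamma> ` {t - d/2<..<t + d/2})"
    using rec d(1) unfolding everywhere_recurrent_def by auto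
  then obtain z where z: "z \<in> N" "infinite {n. (f ^^ n) z \<in> \<gamma> ` {t - d/2<..<t + d/2}}"
    unfolding recurs_def by blast
  have near: "y \<in> \<gamma> ` {t - d/2<..<t + d/2} \<Longrightarrow> (f ^^ m) y \<in> U \<and> (\<forall>i<P. y \<notin> (f ^^ i) ` C)" for y
    using d(1,3,4) by (smt (verit) dist_real_def greaterThanLessThan_iff field_sum_of_halves imageE)
  obtain n where n: "(f ^^ n) z \<in> \<gamma> ` {t - d/2<..<t + d/2}"
    using z(2) by (metis (no_types, lifting) empty_Collect_eq finite.emptyI)
  have inC: "(f ^^ (j * P)) ((f ^^ (m + n)) z) \<in> C" for j
  proof (induction j)
    case 0
    show ?case using near[OF n] *(4) by (auto simp: funpow_add)
  next
    case (Suc j)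
    then show ?case using *(4,6) by (auto simp: funpow_add)
  qed
  have "{k. (f ^^ k) z \<in> \<gamma> ` {t - d/2<..<t + d/2}} \<subseteq> {..<m + n}"
  proof (intro subsetI; rule ccontr)
    fix k assume k: "k \<in> {k. (f ^^ k) z \<in> \<gamma> ` {t - d/2<..<t + d/2}}" "k \<notin> {..<m + n}"
    \<comment> \<open>Beyond time \<open>m + n\<close>, division by \<open>P\<close> splits the
      time: the full multiples of \<open>P\<close> end in \<open>C\<close>, and the remainder is
      below \<open>P\<close>.\<close>
    define l where "l = k - (m + n)"
    have "k = l mod P + (l div P * P + (m + n))" using k(2) by (simp add: l_def)
    then have "(f ^^ k) z = (f ^^ (l mod P)) ((f ^^ (l div P * P)) ((f ^^ (m + n)) z))"
      by (simp only: funpow_add o_apply)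
    then show False
      using near[of "(f ^^ k) z"] k(1) inC[of "l div P"] *(1) by (metis imageI mem_Collect_eq mod_less_divisor)
  qed
  then show False using z(2) finite_subset by blast
qed

lemma traps_robust:
  assumes "f \<in> C1" "traps f p q" "{p<..<q} \<subseteq> I"
  shows "\<exists>e>0. \<forall>g\<in>C1. near e f g \<longrightarrow> traps g p q"
proof -
  obtain C U P m x where *: "0 < P" "compact C" "C \<subseteq> N" "U \<subseteq> C" "openin (top_of_set N) U"
     "(f ^^ P) ` C \<subseteq> U" "(f ^^ m) x \<in> U" "x \<in> \<gamma> ` {p<..<q}" "\<And>i. i < P \<Longrightarrow> x \<notin> (f ^^ i) ` C"
    using assms(2) unfolding traps_def by blast
  have xN: "x \<in> N" using *(8) assms(3) param_in by blast
  have comp: "compact ((f ^^ i) ` C)" for i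
    by (intro compact_continuous_image continuous_on_subset[OF iterate_continuous[OF assms(1)]] *)
  have sep: "\<exists>d>0. \<forall>y\<in>A. \<forall>z\<in>N. dist y z < d \<longrightarrow> z \<in> T"
    if A: "compact A" "openin (top_of_set N) T" "A \<subseteq> T" for A T
  proof -
    obtain S where S: "open S" "T = N \<inter> S" using A(2) openin_open by blast
    have "A \<inter> - S = {}" using A(3) S(2) by blast
    from separate_compact_closed[OF A(1) _ this]
    obtain d where d: "d > 0" "\<forall>y\<in>A. \<forall>z\<in>- S. d \<le> dist y z" using S(1) by auto
    show ?thesis
    proof (intro exI[of _ d] conjI ballI impI d(1))
      fix y z assume "y \<in> A" "z \<in> N" "dist y z < d"
      then show "z \<in> T" using d(2) S(2) by (metis ComplI IntI linorder_not_less)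
    qed
  qed
  obtain d1 where d1: "d1 > 0" "\<forall>y\<in>(f ^^ P) ` C. \<forall>z\<in>N. dist y z < d1 \<longrightarrow> z \<in> U"
    using sep[OF comp *(5,6)] by blast
  obtain d2 where d2: "d2 > 0" "\<forall>y\<in>{(f ^^ m) x}. \<forall>z\<in>N. dist y z < d2 \<longrightarrow> z \<in> U"
    using sep[of "{(f ^^ m) x}", OF _ *(5)] *(7) by auto
  have "\<exists>d>0. \<forall>y\<in>(f ^^ i) ` C. \<forall>z\<in>N. dist y z < d \<longrightarrow> z \<in> N - {x}" if "i < P" for i
    using *(3,9) that iterate_in[OF assms(1)] by (intro sep comp openin_delete) auto
  then obtain d3 where d3: "\<And>i. i < P \<Longrightarrow> d3 i > 0"
      "\<And>i y z. i < P \<Longrightarrow> y \<in> (f ^^ i) ` C \<Longrightarrow> z \<in> N \<Longrightarrow> dist y z < d3 i \<Longrightarrow> z \<noteq> x"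
    by (metis DiffE singletonI)
  note it = iterates_near[OF compact_N C1_continuous[OF assms(1)] C1_into[OF assms(1)]]
  obtain e1 where e1: "e1 > 0" "\<forall>g\<in>N \<rightarrow> N. (\<forall>x\<in>N. dist (f x) (g x) < e1) \<longrightarrow>
           (\<forall>x\<in>N. dist ((f ^^ P) x) ((g ^^ P) x) < d1)"
    using it[OF d1(1)] by blast
  obtain e2 where e2: "e2 > 0" "\<forall>g\<in>N \<rightarrow> N. (\<forall>x\<in>N. dist (f x) (g x) < e2) \<longrightarrow>
           (\<forall>x\<in>N. dist ((f ^^ m) x) ((g ^^ m) x) < d2)"
    using it[OF d2(1)] by blast
  have "\<forall>i\<in>{..<P}. \<exists>e>0. \<forall>g\<in>N \<rightarrow> N. (\<forall>x\<in>N. dist (f x) (g x) < e) \<longrightarrow>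
           (\<forall>x\<in>N. dist ((f ^^ i) x) ((g ^^ i) x) < d3 i)"
    using it d3(1) by blast
  then obtain e3 where e3: "\<And>i. i < P \<Longrightarrow> e3 i > 0" "\<And>i g. i < P \<Longrightarrow> g \<in> N \<rightarrow> N \<Longrightarrow>
      (\<forall>x\<in>N. dist (f x) (g x) < e3 i) \<Longrightarrow> (\<forall>x\<in>N. dist ((f ^^ i) x) ((g ^^ i) x) < d3 i)"
    unfolding Ball_def lessThan_iff by metis
  define e where "e = Min ({e1, e2} \<union> e3 ` {..<P})"
  have e: "e > 0" "e \<le> e1" "e \<le> e2" "\<And>i. i < P \<Longrightarrow> e \<le> e3 i"
  proof -
    show "e > 0" unfolding e_def using e1(1) e2(1) e3(1) by auto
    show "e \<le> e1" "e \<le> e2" "\<And>i. i < P \<Longrightarrow> e \<le> e3 i"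
      unfolding e_def by (intro Min_le; auto)+
  qed
  show ?thesis
  proof (intro exI[of _ e] conjI ballI impI e(1))
    fix g assume g: "g \<in> C1" "near e f g"
    have le: "\<forall>x\<in>N. dist (f x) (g x) < e'" if "e \<le> e'" for e'
      using g(2) that unfolding C1_near_def by force
    note gN = C1_into[OF g(1)]
    have "(g ^^ P) ` C \<subseteq> U"
      using e1(2) gN le[OF e(2)] d1(2) *(3) iterate_in[OF g(1)] by blast
    moreover have "(g ^^ m) x \<in> U"
      using e2(2) gN le[OF e(3)] d2(2) xN iterate_in[OF g(1)] by blast
    moreover have "x \<notin> (g ^^ i) ` C" if "i < P" for i
      using e3(2)[OF that gN le[OF e(4)[OF that]]] d3(2)[OF that] *(3) iterate_in[OF g(1)] by blast
    ultimately show "traps g p q"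
      unfolding traps_def using *(1-5,8) by blast
  qed
qed

end


section \<open>Creating sinks by small perturbations\<close>

text \<open>The bound \<open>\<kappa>\<close> below does not depend on \<open>\<tau>\<close> and \<open>\<delta>\<close>: at a critical point, the scale \<open>\<delta>\<close> is chosen
  only after \<open>\<kappa>\<close>.\<close>

locale perturbable_curve = parametrised_curve +
  assumes lift_exists: "\<And>f. f \<in> C1 \<Longrightarrow> \<exists>F F'. lift f F F'"
    and perturb: "\<And>f F F' e. f \<in> C1 \<Longrightarrow> lift f F F' \<Longrightarrow> 0 < e \<Longrightarrow>
      \<exists>\<kappa>>0. \<forall>\<tau>\<in>I. \<forall>\<delta> u u'. 0 < \<delta> \<longrightarrow> 2 * \<delta> < w \<longrightarrow>
        (\<forall>t\<in>I. (u has_real_derivative u' t) (at t within I) \<and> F t + u t \<in> I \<and>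
           \<bar>u t\<bar> < \<kappa> \<and> \<bar>u' t\<bar> < \<kappa> \<and> (\<delta> \<le> \<bar>t - \<tau>\<bar> \<longrightarrow> u t = 0 \<and> u' t = 0)) \<longrightarrow>
        continuous_on I u' \<longrightarrow>
        (\<exists>g\<in>C1. near e f g \<and> (\<forall>t\<in>I. \<bar>t - \<tau>\<bar> < \<delta> \<longrightarrow> g (\<gamma> t) = \<gamma> (F t + u t)) \<and>
           (\<forall>x\<in>N - \<gamma> ` (I \<inter> ball \<tau> \<delta>). g x = f x))"
begin

text \<open>The new lift is \<open>F\<close> plus \<open>\<phi> * s * (V - F)\<close>, a convex
  combination of \<open>F\<close> and \<open>V\<close>, so it stays in \<open>I\<close>. With
  \<open>s = 1\<close> the map becomes constant near \<open>\<tau>\<close>; a small \<open>s\<close>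
  pulls it slightly towards \<open>V\<close>.\<close>

lemma perturb_towards:
  assumes "f \<in> C1" "lift f F F'" "0 < e"
  shows "\<exists>\<kappa>>0. \<forall>\<tau>\<in>I. \<forall>\<delta> s. \<forall>V\<in>I. 0 < \<delta> \<longrightarrow> \<delta> \<le> 1 \<longrightarrow> 2 * \<delta> < w \<longrightarrow> 0 \<le> s \<longrightarrow> s \<le> 1 \<longrightarrow>
    (\<forall>t\<in>I. \<bar>t - \<tau>\<bar> < \<delta> \<longrightarrow> s * \<bar>V - F t\<bar> \<le> \<kappa> * \<delta> \<and> s * \<bar>F' t\<bar> \<le> \<kappa>) \<longrightarrow>
    (\<exists>g\<in>C1. near e f g \<and> (\<forall>t\<in>I. \<bar>t - \<tau>\<bar> \<le> \<delta> / 2 \<longrightarrow> g (\<gamma> t) = \<gamma> (F t + s * (V - F t))) \<and>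
       (\<forall>x\<in>N - \<gamma> ` (I \<inter> ball \<tau> \<delta>). g x = f x))"
proof -
  obtain \<kappa>0 where \<kappa>0: "0 < \<kappa>0" and pert: "\<forall>\<tau>\<in>I. \<forall>\<delta> u u'. 0 < \<delta> \<longrightarrow> 2 * \<delta> < w \<longrightarrow>
        (\<forall>t\<in>I. (u has_real_derivative u' t) (at t within I) \<and> F t + u t \<in> I \<and>
           \<bar>u t\<bar> < \<kappa>0 \<and> \<bar>u' t\<bar> < \<kappa>0 \<and> (\<delta> \<le> \<bar>t - \<tau>\<bar> \<longrightarrow> u t = 0 \<and> u' t = 0)) \<longrightarrow>
        continuous_on I u' \<longrightarrow>
        (\<exists>g\<in>C1. near e f g \<and> (\<forall>t\<in>I. \<bar>t - \<tau>\<bar> < \<delta> \<longrightarrow> g (\<gamma> t) = \<gamma> (F t + u t)) \<and>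
           (\<forall>x\<in>N - \<gamma> ` (I \<inter> ball \<tau> \<delta>). g x = f x))"
    using perturb[OF assms] by (elim exE conjE) (rule that)
  \<comment> \<open>The derivative of \<open>u\<close> is bounded by \<open>11 * \<kappa>\<close>
    from the slope of the bump plus \<open>\<kappa>\<close> from \<open>F'\<close>; dividing by 13
    makes the total strictly less than \<open>\<kappa>0\<close>.\<close>
  define \<kappa> where "\<kappa> = \<kappa>0 / 13"
  show ?thesis
  proof (intro exI[of _ \<kappa>] conjI ballI allI impI)
    show "0 < \<kappa>" using \<kappa>0 by (simp add: \<kappa>_def)
    fix \<tau> \<delta> s V
    assume *: "\<tau> \<in> I" "V \<in> I" "0 < \<delta>" "\<delta> \<le> 1" "2 * \<delta> < w" "0 \<le> s" "s \<le> 1"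
      and bound: "\<forall>t\<in>I. \<bar>t - \<tau>\<bar> < \<delta> \<longrightarrow> s * \<bar>V - F t\<bar> \<le> \<kappa> * \<delta> \<and> s * \<bar>F' t\<bar> \<le> \<kappa>"
    obtain \<phi> \<phi>' where "(\<forall>t. (\<phi> has_real_derivative \<phi>' t) (at t)) \<and> continuous_on UNIV \<phi>' \<and>
      (\<forall>t. 0 \<le> \<phi> t \<and> \<phi> t \<le> 1 \<and> \<bar>\<phi>' t\<bar> \<le> 11 / \<delta>) \<and>
      (\<forall>t. \<bar>t - \<tau>\<bar> \<le> \<delta> / 2 \<longrightarrow> \<phi> t = 1) \<and> (\<forall>t. \<delta> \<le> \<bar>t - \<tau>\<bar> \<longrightarrow> \<phi> t = 0 \<and> \<phi>' t = 0)"
      using C1_bump[OF *(3), of \<tau>] by (elim exE) (rule that)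
    then have \<phi>: "\<And>t. (\<phi> has_real_derivative \<phi>' t) (at t)" "continuous_on UNIV \<phi>'"
      "\<And>t. 0 \<le> \<phi> t" "\<And>t. \<phi> t \<le> 1" "\<And>t. \<bar>\<phi>' t\<bar> \<le> 11 / \<delta>"
      "\<And>t. \<bar>t - \<tau>\<bar> \<le> \<delta> / 2 \<Longrightarrow> \<phi> t = 1" "\<And>t. \<delta> \<le> \<bar>t - \<tau>\<bar> \<Longrightarrow> \<phi> t = 0 \<and> \<phi>' t = 0"
      by blast+
    define u where "u t = \<phi> t * (s * (V - F t))" for t
    define u' where "u' t = \<phi>' t * (s * (V - F t)) + s * (0 - F' t) * \<phi> t" for t
    have d: "(u has_real_derivative u' t) (at t within I)" if "t \<in> I" for t
      unfolding u_def u'_def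
      by (intro DERIV_mult DERIV_cmult DERIV_diff DERIV_const lift_DERIV[OF assms(2)] that
          has_field_derivative_at_within[OF \<phi>(1)])
    have inI: "F t + u t \<in> I" if "t \<in> I" for t
    proof -
      have "(1 - \<phi> t * s) *\<^sub>R F t + (\<phi> t * s) *\<^sub>R V \<in> I"
        using \<phi>(3,4) * mult_le_one[of "\<phi> t" s]
        by (intro convexD[OF convex_I] lift_into[OF assms(2)] that) auto
      then show ?thesis by (simp add: u_def algebra_simps)
    qed
    have zero: "u t = 0 \<and> u' t = 0" if "\<delta> \<le> \<bar>t - \<tau>\<bar>" for t
      using \<phi>(7)[OF that] by (simp add: u_def u'_def)
    have small: "\<bar>u t\<bar> < \<kappa>0 \<and> \<bar>u' t\<bar> < \<kappa>0" if t: "t \<in> I" for t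
    proof (cases "\<delta> \<le> \<bar>t - \<tau>\<bar>")
      case True
      then show ?thesis using zero \<kappa>0 by simp
    next
      case False
      define A where "A = s * \<bar>V - F t\<bar>"
      have A: "0 \<le> A" "A \<le> \<kappa> * \<delta>" and B: "s * \<bar>F' t\<bar> \<le> \<kappa>"
        using bound t False *(6) by (auto simp: A_def)
      have "\<bar>u t\<bar> = \<phi> t * A"
        using \<phi>(3) *(6) by (simp add: u_def A_def abs_mult)
      also have "\<dots> \<le> 1 * (\<kappa> * \<delta>)"
        using \<phi>(3,4) A by (intro mult_mono) auto
      also have "\<dots> \<le> \<kappa>" using *(4) \<kappa>0 by (simp add: \<kappa>_def mult_left_le)
      finally have 1: "\<bar>u t\<bar> < \<kappa>0" using \<kappa>0 by (simp add: \<kappa>_def)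
      have "\<bar>\<phi>' t * (s * (V - F t))\<bar> = \<bar>\<phi>' t\<bar> * A"
        using *(6) by (simp add: A_def abs_mult)
      also have "\<dots> \<le> 11 / \<delta> * (\<kappa> * \<delta>)"
        using \<phi>(5) A *(3) by (intro mult_mono) auto
      finally have 2: "\<bar>\<phi>' t * (s * (V - F t))\<bar> \<le> 11 * \<kappa>" using *(3) by simp
      have "\<bar>s * (0 - F' t) * \<phi> t\<bar> = (s * \<bar>F' t\<bar>) * \<phi> t"
        using \<phi>(3) *(6) by (simp add: abs_mult)
      also have "\<dots> \<le> \<kappa> * 1"
        using \<phi>(3,4) B \<kappa>0 by (intro mult_mono) (auto simp: \<kappa>_def)
      finally have "\<bar>u' t\<bar> \<le> 12 * \<kappa>"
        using 2 unfolding u'_def by linarith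
      then show ?thesis using 1 \<kappa>0 by (simp add: \<kappa>_def)
    qed
    have "continuous_on I \<phi>" "continuous_on I \<phi>'"
      using continuous_on_subset[OF \<phi>(2)] DERIV_isCont[OF \<phi>(1)]
      by (auto intro: continuous_at_imp_continuous_on)
    then have "continuous_on I u'"
      unfolding u'_def
      by (intro continuous_on_add continuous_on_mult continuous_on_diff continuous_on_const
          lift_continuous[OF assms(2)] lift_continuous_deriv[OF assms(2)])
    moreover have "\<forall>t\<in>I. (u has_real_derivative u' t) (at t within I) \<and> F t + u t \<in> I \<and>
           \<bar>u t\<bar> < \<kappa>0 \<and> \<bar>u' t\<bar> < \<kappa>0 \<and> (\<delta> \<le> \<bar>t - \<tau>\<bar> \<longrightarrow> u t = 0 \<and> u' t = 0)"
      using d inI zero small by simp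
    ultimately have "\<exists>g\<in>C1. near e f g \<and>
        (\<forall>t\<in>I. \<bar>t - \<tau>\<bar> < \<delta> \<longrightarrow> g (\<gamma> t) = \<gamma> (F t + u t)) \<and>
        (\<forall>x\<in>N - \<gamma> ` (I \<inter> ball \<tau> \<delta>). g x = f x)"
      using *(1,3,5) by (intro pert[THEN bspec, THEN spec, THEN spec, THEN spec, THEN mp, THEN mp, THEN mp, THEN mp])
    then obtain g where g: "g \<in> C1" "near e f g"
        "\<forall>t\<in>I. \<bar>t - \<tau>\<bar> < \<delta> \<longrightarrow> g (\<gamma> t) = \<gamma> (F t + u t)"
        "\<forall>x\<in>N - \<gamma> ` (I \<inter> ball \<tau> \<delta>). g x = f x"
      by (elim bexE conjE) (rule that)
    then show "\<exists>g\<in>C1. near e f g \<and> (\<forall>t\<in>I. \<bar>t - \<tau>\<bar> \<le> \<delta> / 2 \<longrightarrow> g (\<gamma> t) = \<gamma> (F t + s * (V - F t))) \<and>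
       (\<forall>x\<in>N - \<gamma> ` (I \<inter> ball \<tau> \<delta>). g x = f x)"
    proof (intro bexI[of _ g] conjI ballI impI)
      fix t assume t: "t \<in> I" "\<bar>t - \<tau>\<bar> \<le> \<delta> / 2"
      then have "\<bar>t - \<tau>\<bar> < \<delta>" using *(3) by simp
      then show "g (\<gamma> t) = \<gamma> (F t + s * (V - F t))"
        using g(3) t \<phi>(6)[OF t(2)] by (simp add: u_def)
    qed (use g in auto)
  qed
qed

text \<open>Restarting the recurrent orbit at one of two visits whose times are congruent modulo
  \<open>P\<close> gives a point of the arc that returns to the arc.\<close>

lemma recurrent_return:
  assumes "f \<in> everywhere_recurrent p q" "p \<le> r" "r < s" "s \<le> q" "0 < P"
  shows "\<exists>y\<in>\<gamma> ` {r<..<s}. \<exists>j>0. (f ^^ (P * j)) y \<in> \<gamma> ` {r<..<s}"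
proof -
  have "recurs f (\<gamma> ` {r<..<s})"
    using assms unfolding everywhere_recurrent_def by blast
  then obtain z where "infinite {n. (f ^^ n) z \<in> \<gamma> ` {r<..<s}}"
    unfolding recurs_def by blast
  from infinite_nat_congruent_pair[OF this assms(5)]
  obtain m j where "(f ^^ m) z \<in> \<gamma> ` {r<..<s}" "(f ^^ (m + P * j)) z \<in> \<gamma> ` {r<..<s}" "0 < j"
    by blast
  then show ?thesis
    by (intro bexI[of _ "(f ^^ m) z"] exI[of _ j]) (auto simp: funpow_add add.commute[of m])
qed

text \<open>The cycle created attracts in a strong sense: \<open>g ^^ M\<close> collapses a
  neighbourhood of \<open>v\<close> onto \<open>v\<close>. The whole of \<open>J\<close> lands on
  \<open>v\<close> after \<open>Suc k\<close> steps while the cycle is finite, so some point of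
  \<open>J\<close> off the cycle witnesses \<open>traps\<close>.\<close>

lemma critical_traps:
  assumes f: "f \<in> everywhere_recurrent p q" and pq: "{p<..<q} \<subseteq> I" and F: "lift f F F'"
    and t: "t \<in> {p<..<q}" and crit: "F' ((F ^^ n) t) = 0" and e: "0 < e"
  shows "\<exists>g\<in>C1. near e f g \<and> traps g p q"
proof -
  have fC: "f \<in> C1" using f unfolding everywhere_recurrent_def by blast
  have tI: "t \<in> I" "t \<in> interior I" using t pq interval_interior[OF pq] by auto
  define \<tau> where "\<tau> = (F ^^ n) t"
  have \<tau>: "\<tau> \<in> I" "(f ^^ n) (\<gamma> t) = \<gamma> \<tau>" "F' \<tau> = 0"
    using lift_iterate(1,2)[OF F tI(1)] crit by (auto simp: \<tau>_def)
  \<comment> \<open>Taking the first arrival at \<open>\<gamma> \<tau>\<close> keeps the earlier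
    iterates away from the support of the perturbation, so \<open>g\<close> carries a small arc
    around \<open>t\<close> to \<open>D'\<close> exactly as \<open>f\<close> does.\<close>
  define k where "k = (LEAST k. (f ^^ k) (\<gamma> t) = \<gamma> \<tau>)"
  have k: "(f ^^ k) (\<gamma> t) = \<gamma> \<tau>" "\<And>i. i < k \<Longrightarrow> (f ^^ i) (\<gamma> t) \<noteq> \<gamma> \<tau>"
    using LeastI[of "\<lambda>k. (f ^^ k) (\<gamma> t) = \<gamma> \<tau>" n] \<tau>(2) not_less_Least
    unfolding k_def by blast+
  obtain \<kappa> where \<kappa>: "\<kappa> > 0" and pert: "\<forall>\<tau>\<in>I. \<forall>\<delta> s. \<forall>V\<in>I. 0 < \<delta> \<longrightarrow> \<delta> \<le> 1 \<longrightarrow> 2 * \<delta> < w \<longrightarrow> 0 \<le> s \<longrightarrow> s \<le> 1 \<longrightarrow>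
    (\<forall>t\<in>I. \<bar>t - \<tau>\<bar> < \<delta> \<longrightarrow> s * \<bar>V - F t\<bar> \<le> \<kappa> * \<delta> \<and> s * \<bar>F' t\<bar> \<le> \<kappa>) \<longrightarrow>
    (\<exists>g\<in>C1. near e f g \<and> (\<forall>t\<in>I. \<bar>t - \<tau>\<bar> \<le> \<delta> / 2 \<longrightarrow> g (\<gamma> t) = \<gamma> (F t + s * (V - F t))) \<and>
       (\<forall>x\<in>N - \<gamma> ` (I \<inter> ball \<tau> \<delta>). g x = f x))"
    using perturb_towards[OF fC F e] by (elim exE conjE) (rule that)
  have "\<exists>d>0. \<forall>x\<in>I. dist x \<tau> < d \<longrightarrow> dist (F' x) (F' \<tau>) < \<kappa> / 2"
    using lift_continuous_deriv[OF F] \<tau>(1) \<kappa> unfolding continuous_on_iff by (meson half_gt_zero)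
  then obtain d1 where d1: "d1 > 0" "\<And>x. x \<in> I \<Longrightarrow> \<bar>x - \<tau>\<bar> < d1 \<Longrightarrow> \<bar>F' x\<bar> \<le> \<kappa> / 2"
    using \<tau>(3) by (auto simp: dist_real_def less_imp_le)
  have "\<exists>d>0. \<forall>x\<in>I. \<bar>x - \<tau>\<bar> < d \<longrightarrow> \<gamma> x \<noteq> (f ^^ i) (\<gamma> t)" if "i < k" for i
  proof -
    have "dist ((f ^^ i) (\<gamma> t)) (\<gamma> \<tau>) > 0" using k(2)[OF that] by simp
    then obtain d where "d > 0" "\<forall>x\<in>I. dist x \<tau> < d \<longrightarrow> dist (\<gamma> x) (\<gamma> \<tau>) < dist ((f ^^ i) (\<gamma> t)) (\<gamma> \<tau>)"
      using continuous_param \<tau>(1) unfolding continuous_on_iff by meson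
    then show ?thesis by (intro exI[of _ d]) (auto simp: dist_real_def)
  qed
  then obtain d2 where d2: "\<And>i. i < k \<Longrightarrow> d2 i > 0"
    "\<And>i x. i < k \<Longrightarrow> x \<in> I \<Longrightarrow> \<bar>x - \<tau>\<bar> < d2 i \<Longrightarrow> \<gamma> x \<noteq> (f ^^ i) (\<gamma> t)"
    by metis
  \<comment> \<open>\<open>d1\<close> bounds \<open>F'\<close> by \<open>\<kappa> / 2\<close> near
    \<open>\<tau>\<close>, \<open>w / 3\<close> ensures \<open>2 * \<delta> < w\<close>, and the
    halves of \<open>d2\<close> keep the closed \<open>\<delta>\<close>-neighbourhood off the first
    \<open>k\<close> points of the orbit of \<open>\<gamma> t\<close>.\<close>
  define \<delta> where "\<delta> = Min ({1, d1, w / 3} \<union> (\<lambda>i. d2 i / 2) ` {..<k})"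
  have \<delta>: "\<delta> > 0" "\<delta> \<le> 1" "\<delta> \<le> d1" "2 * \<delta> < w" "\<And>i. i < k \<Longrightarrow> \<delta> \<le> d2 i / 2"
  proof -
    show "\<delta> > 0" unfolding \<delta>_def using d1(1) d2(1) w_pos by auto
    show "\<delta> \<le> 1" "\<delta> \<le> d1" "\<And>i. i < k \<Longrightarrow> \<delta> \<le> d2 i / 2"
      unfolding \<delta>_def by (intro Min_le; auto)+
    have "\<delta> \<le> w / 3" unfolding \<delta>_def by (intro Min_le) auto
    then show "2 * \<delta> < w" using w_pos by simp
  qed
  define D where "D = \<gamma> ` (I \<inter> ball \<tau> \<delta>)"
  define D' where "D' = \<gamma> ` (I \<inter> ball \<tau> (\<delta> / 2))"
  have D'D: "D' \<subseteq> D" unfolding D_def D'_def using \<delta>(1) by auto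
  have D'o: "openin (top_of_set N) D'" unfolding D'_def by (intro openin_param) auto
  have clo: "openin (top_of_set N) (N - \<gamma> ` (I \<inter> cball \<tau> \<delta>))"
    by (intro openin_diff_closed closed_param_cball)
  have "\<forall>\<^sub>F s in nhds t. s \<in> {p<..<q} \<and> (f ^^ k) (\<gamma> s) \<in> D' \<and>
      (\<forall>i\<in>{..<k}. (f ^^ i) (\<gamma> s) \<in> N - \<gamma> ` (I \<inter> cball \<tau> \<delta>))"
  proof (intro eventually_conj eventually_ball_finite ballI eventually_iterate_param[OF fC tI(2)] D'o clo)
    show "(f ^^ k) (\<gamma> t) \<in> D'" unfolding D'_def k(1) using \<tau>(1) \<delta>(1) by auto
    fix i assume "i \<in> {..<k}"
    then show "(f ^^ i) (\<gamma> t) \<in> N - \<gamma> ` (I \<inter> cball \<tau> \<delta>)"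
      using iterate_in[OF fC param_in[OF tI(1)]] d2(1,2)[of i] \<delta>(5)[of i] by (force simp: dist_real_def)
  qed (use eventually_nhds_in_open[OF open_greaterThanLessThan t] in simp_all)
  then obtain d3 where d3: "d3 > 0" "\<And>s. dist s t < d3 \<Longrightarrow> s \<in> {p<..<q}"
      "\<And>s. dist s t < d3 \<Longrightarrow> (f ^^ k) (\<gamma> s) \<in> D'"
      "\<And>s i. dist s t < d3 \<Longrightarrow> i < k \<Longrightarrow> (f ^^ i) (\<gamma> s) \<notin> \<gamma> ` (I \<inter> cball \<tau> \<delta>)"
    unfolding eventually_nhds_metric by blast
  define \<rho> where "\<rho> = min (d3 / 2) (w / 3)"
  have \<rho>: "\<rho> > 0" "\<rho> < d3" "2 * \<rho> < w" unfolding \<rho>_def using d3(1) w_pos by auto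
  define J where "J = {t - \<rho><..<t + \<rho>}"
  have J: "dist s t < d3" if "s \<in> J" for s
    using that \<rho>(2) unfolding J_def dist_real_def by auto
  have JI: "J \<subseteq> I" using J d3(2) pq by blast
  have "p \<le> t - \<rho>" "t + \<rho> \<le> q"
    using \<rho>(1,2) d3(2)[of "t - \<rho>"] d3(2)[of "t + \<rho>"] by (auto simp: dist_real_def)
  from recurrent_return[OF f this(1) _ this(2), of 1] \<rho>(1)
  obtain x j where x: "x \<in> \<gamma> ` J" "0 < j" "(f ^^ j) x \<in> \<gamma> ` J"
    unfolding J_def by auto
  define y where "y = (f ^^ k) x"
  have y: "y \<in> D'" "(f ^^ j) y \<in> D'"
  proof -
    show "y \<in> D'" using x(1) d3(3) J unfolding y_def by blast
    obtain s where "s \<in> J" "(f ^^ j) x = \<gamma> s" using x(3) by blast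
    then have "(f ^^ k) ((f ^^ j) x) \<in> D'" using d3(3)[OF J] by simp
    then show "(f ^^ j) y \<in> D'"
      unfolding y_def by (metis add.commute funpow_add o_apply)
  qed
  \<comment> \<open>last visit to \<open>D\<close> before the return to \<open>D'\<close>: the orbit segment to be closed starts right after it, so
    that it meets the support of the perturbation only at its end\<close>
  define l where "l = Max {l. l < j \<and> (f ^^ l) y \<in> D}"
  have "0 \<in> {l. l < j \<and> (f ^^ l) y \<in> D}" using x(2) y(1) D'D by auto
  then have "{l. l < j \<and> (f ^^ l) y \<in> D} \<noteq> {}" by blast
  then have "l \<in> {l. l < j \<and> (f ^^ l) y \<in> D}"
    unfolding l_def by (intro Max_in) auto
  then have l: "l < j" "(f ^^ l) y \<in> D" by auto
  have l_max: "(f ^^ i) y \<notin> D" if "l < i" "i < j" for i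
  proof
    assume "(f ^^ i) y \<in> D"
    then have "i \<le> l" unfolding l_def using that by (intro Max_ge) auto
    then show False using that by simp
  qed
  obtain \<sigma> where \<sigma>: "\<sigma> \<in> I" "\<bar>\<sigma> - \<tau>\<bar> < \<delta>" "(f ^^ l) y = \<gamma> \<sigma>"
    using l(2) unfolding D_def by (auto simp: dist_real_def abs_minus_commute)
  \<comment> \<open>\<open>g\<close> will send the whole of \<open>D'\<close> to \<open>v\<close>,
    the point following the last visit to \<open>D\<close>.\<close>
  define v where "v = \<gamma> (F \<sigma>)"
  have v: "v = (f ^^ Suc l) y" "v \<in> N"
    unfolding v_def using \<sigma> lift_eq[OF F] lift_into[OF F] param_in by auto
  \<comment> \<open>Parameters within \<open>\<delta>\<close> of \<open>\<tau>\<close> differ by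
    less than \<open>2 * \<delta>\<close> and \<open>F'\<close> is at most
    \<open>\<kappa> / 2\<close> in modulus there, so \<open>F\<close> oscillates by at most
    \<open>\<kappa> * \<delta>\<close>. The factor 1 is the weight \<open>s\<close> of a complete
    pull to \<open>F \<sigma>\<close>.\<close>
  have bound: "1 * \<bar>F \<sigma> - F s\<bar> \<le> \<kappa> * \<delta> \<and> 1 * \<bar>F' s\<bar> \<le> \<kappa>" if s: "s \<in> I" "\<bar>s - \<tau>\<bar> < \<delta>" for s
  proof -
    have "norm (F \<sigma> - F s) \<le> \<kappa> / 2 * norm (\<sigma> - s)"
    proof (rule field_differentiable_bound[of "I \<inter> ball \<tau> \<delta>" F F'])
      show "convex (I \<inter> ball \<tau> \<delta>)" using convex_I by (intro convex_Int) auto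
      fix z assume z: "z \<in> I \<inter> ball \<tau> \<delta>"
      then show "(F has_real_derivative F' z) (at z within I \<inter> ball \<tau> \<delta>)"
        using lift_DERIV[OF F] by (blast intro: has_field_derivative_subset)
      show "norm (F' z) \<le> \<kappa> / 2" using z d1(2) \<delta>(3) by (auto simp: dist_real_def abs_minus_commute)
    qed (use s \<sigma> in \<open>auto simp: dist_real_def abs_minus_commute\<close>)
    also have "\<dots> \<le> \<kappa> / 2 * (2 * \<delta>)"
      using s(2) \<sigma>(2) \<kappa> by (intro mult_left_mono) auto
    finally show ?thesis using d1(2)[OF s(1)] s(2) \<delta>(3) \<kappa> by simp
  qed
  have "\<exists>g\<in>C1. near e f g \<and>
      (\<forall>t\<in>I. \<bar>t - \<tau>\<bar> \<le> \<delta> / 2 \<longrightarrow> g (\<gamma> t) = \<gamma> (F t + 1 * (F \<sigma> - F t))) \<and>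
      (\<forall>x\<in>N - D. g x = f x)"
    unfolding D_def using bound \<tau>(1) lift_into[OF F \<sigma>(1)] \<delta>(1,2,4)
    by (intro pert[THEN bspec, THEN spec, THEN spec, THEN bspec, THEN mp, THEN mp, THEN mp, THEN mp, THEN mp, THEN mp]) simp_all
  then obtain g where g0: "g \<in> C1" "near e f g"
      "\<forall>t\<in>I. \<bar>t - \<tau>\<bar> \<le> \<delta> / 2 \<longrightarrow> g (\<gamma> t) = \<gamma> (F t + 1 * (F \<sigma> - F t))"
      "\<forall>x\<in>N - D. g x = f x"
    by (elim bexE conjE) (rule that)
  note g = g0(1,2)
  have g_flat: "g (\<gamma> s) = v" if "s \<in> I" "\<bar>s - \<tau>\<bar> \<le> \<delta> / 2" for s
    using g0(3) that unfolding v_def by simp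
  have g_off: "g x = f x" if "x \<in> N" "x \<notin> D" for x
    using g0(4) that by blast
  have gD': "g x = v" if "x \<in> D'" for x
    using that g_flat unfolding D'_def by (auto simp: dist_real_def abs_minus_commute)
  define M where "M = j - l"
  have M: "0 < M" using l(1) by (simp add: M_def)
  have yN: "y \<in> N" using y(1) D'o openin_imp_subset by blast
  have orbit: "(g ^^ i) v = (f ^^ (Suc l + i)) y" if "i < M" for i
    using that
  proof (induction i)
    case (Suc i)
    have "(f ^^ (Suc l + i)) y \<notin> D" using Suc.prems by (intro l_max) (auto simp: M_def)
    then have "g ((f ^^ (Suc l + i)) y) = f ((f ^^ (Suc l + i)) y)"
      by (intro g_off iterate_in[OF fC yN])
    then show ?case using Suc by simp
  qed (simp add: v(1))
  \<comment> \<open>As \<open>v\<close> is the iterate of \<open>y\<close> at time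
    \<open>Suc l\<close>, \<open>M - 1\<close> further steps lead to time \<open>j\<close>, the
    return to \<open>D'\<close>. One more step of \<open>g\<close> gives \<open>v\<close>
    again.\<close>
  have ret: "(g ^^ (M - 1)) v \<in> D'"
    using orbit[of "M - 1"] M y(2) l(1) by (simp add: M_def)
  have start: "(g ^^ i) (\<gamma> s) = (f ^^ i) (\<gamma> s)" if "s \<in> J" "i \<le> k" for s i
    using that(2)
  proof (induction i)
    case (Suc i)
    have "(f ^^ i) (\<gamma> s) \<notin> D"
    proof
      assume "(f ^^ i) (\<gamma> s) \<in> D"
      then have "(f ^^ i) (\<gamma> s) \<in> \<gamma> ` (I \<inter> cball \<tau> \<delta>)" unfolding D_def by auto
      then show False using d3(4)[OF J[OF that(1)], of i] Suc.prems by simp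
    qed
    then have "g ((f ^^ i) (\<gamma> s)) = f ((f ^^ i) (\<gamma> s))"
      using JI that(1) by (intro g_off iterate_in[OF fC param_in]) blast+
    then show ?case using Suc by simp
  qed simp
  have hit: "(g ^^ Suc k) (\<gamma> s) = v" if "s \<in> J" for s
    using start[OF that, of k] d3(3)[OF J[OF that]] gD' by simp
  \<comment> \<open>Injectivity on the short interval makes the arc infinite, so it is not contained
    in the finite cycle.\<close>
  have "inj_on \<gamma> J"
  proof (rule inj_onI)
    fix a b assume ab: "a \<in> J" "b \<in> J" "\<gamma> a = \<gamma> b"
    then have "\<bar>a - b\<bar> < w" using \<rho>(3) unfolding J_def by auto
    then show "a = b" using inj_short ab JI by blast
  qed
  moreover have "infinite J"
    using infinite_Ioo[of "t - \<rho>" "t + \<rho>"] \<rho>(1) unfolding J_def by simp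
  ultimately have "infinite (\<gamma> ` J)"
    using finite_imageD by blast
  then have "\<not> \<gamma> ` J \<subseteq> (\<lambda>i. (g ^^ i) v) ` {..<M}"
    by (meson finite_imageI finite_lessThan finite_subset)
  then obtain s where s0: "s \<in> J" "\<gamma> s \<notin> (\<lambda>i. (g ^^ i) v) ` {..<M}" by blast
  have s: "s \<in> J" "\<And>i. i < M \<Longrightarrow> (g ^^ i) v \<noteq> \<gamma> s"
    using s0 by (metis imageI lessThan_iff)+
  have sN: "\<gamma> s \<in> N" using s(1) JI param_in by blast
  \<comment> \<open>Near \<open>v\<close>, \<open>M - 1\<close> steps still end in
    \<open>D'\<close>, where \<open>g\<close> is constant. The second clause keeps the images of the
    neighbourhood off \<open>\<gamma> s\<close>.\<close>
  have "\<forall>\<^sub>F x in nhds v. (x \<in> N \<longrightarrow> (g ^^ (M - 1)) x \<in> D') \<and>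
      (\<forall>i\<in>{..<M}. x \<in> N \<longrightarrow> (g ^^ i) x \<in> N - {\<gamma> s})"
  proof (intro eventually_conj eventually_ball_finite ballI)
    show "\<forall>\<^sub>F x in nhds v. x \<in> N \<longrightarrow> (g ^^ (M - 1)) x \<in> D'"
      by (rule eventually_iterate[OF g(1) v(2) D'o ret])
    show "\<forall>\<^sub>F x in nhds v. x \<in> N \<longrightarrow> (g ^^ i) x \<in> N - {\<gamma> s}" if "i \<in> {..<M}" for i
      using s(2) that iterate_in[OF g(1) v(2)]
      by (intro eventually_iterate[OF g(1) v(2)] openin_diff_closed) auto
  qed simp
  then obtain r0 where r0: "r0 > 0" "\<And>x. dist x v < r0 \<Longrightarrow> x \<in> N \<Longrightarrow> (g ^^ (M - 1)) x \<in> D'"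
     "\<And>x i. dist x v < r0 \<Longrightarrow> x \<in> N \<Longrightarrow> i < M \<Longrightarrow> (g ^^ i) x \<noteq> \<gamma> s"
  proof -
    assume r: thesis if "r0 > 0" "\<And>x. dist x v < r0 \<Longrightarrow> x \<in> N \<Longrightarrow> (g ^^ (M - 1)) x \<in> D'"
     "\<And>x i. dist x v < r0 \<Longrightarrow> x \<in> N \<Longrightarrow> i < M \<Longrightarrow> (g ^^ i) x \<noteq> \<gamma> s" for r0
    from \<open>\<forall>\<^sub>F x in nhds v. _ x\<close> obtain d where d: "d > 0" "\<And>x. dist x v < d \<Longrightarrow> (x \<in> N \<longrightarrow> (g ^^ (M - 1)) x \<in> D') \<and>
      (\<forall>i\<in>{..<M}. x \<in> N \<longrightarrow> (g ^^ i) x \<in> N - {\<gamma> s})"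
      unfolding eventually_nhds_metric by meson
    show thesis using r[OF d(1)] d(2) by simp
  qed
  define C where "C = N \<inter> cball v (r0 / 2)"
  define U where "U = N \<inter> ball v (r0 / 2)"
  have C: "x \<in> N" "dist x v < r0" if "x \<in> C" for x
    using that r0(1) unfolding C_def by (auto simp: dist_commute)
  have "traps g p q"
    unfolding traps_def
  proof (intro exI conjI allI impI)
    show "compact C" unfolding C_def using compact_N by (intro compact_Int) auto
    show "C \<subseteq> N" "U \<subseteq> C" unfolding C_def U_def by auto
    show "openin (top_of_set N) U" unfolding U_def by (simp add: openin_open_Int)
    have vU: "v \<in> U" using v(2) r0(1) by (simp add: U_def)
    have "(g ^^ M) x = v" if "x \<in> C" for x
      using gD'[OF r0(2)[OF C(2,1)]] that M by (cases M) auto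
    then show "(g ^^ M) ` C \<subseteq> U" using vU by auto
    show "(g ^^ Suc k) (\<gamma> s) \<in> U" using hit[OF s(1)] vU by simp
    show "\<gamma> s \<in> \<gamma> ` {p<..<q}" using d3(2) J s(1) by blast
    show "\<gamma> s \<notin> (g ^^ i) ` C" if "i < M" for i
    proof
      assume "\<gamma> s \<in> (g ^^ i) ` C"
      then obtain x where "x \<in> C" "\<gamma> s = (g ^^ i) x" by blast
      then show False using r0(3)[OF C(2,1) that] by metis
    qed
  qed (rule M)
  then show ?thesis using g(1,2) by blast
qed

text \<open>A return of the arc yields a branch \<open>G\<close> of the lifted iterate that maps an
  interval \<open>K\<close> containing the arc into itself. Without critical points \<open>G\<close>
  is strictly monotone on \<open>K\<close>, so its square \<open>H\<close> is increasing, and an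
  increasing map can be recurrent on every subarc only if it fixes each point of the arc.\<close>

lemma noncritical_periodic:
  assumes f: "f \<in> everywhere_recurrent p q" and "p < q" and pq: "{p<..<q} \<subseteq> I" and F: "lift f F F'"
    and noncrit: "\<And>t n. t \<in> {p<..<q} \<Longrightarrow> F' ((F ^^ n) t) \<noteq> 0"
    and proper: "(\<Union>n. (f ^^ n) ` \<gamma> ` {p<..<q}) \<noteq> N"
  shows "\<exists>P>0. \<forall>t\<in>{p<..<q}. (f ^^ P) (\<gamma> t) = \<gamma> t"
proof -
  have fC: "f \<in> C1" using f unfolding everywhere_recurrent_def by blast
  define J where "J = {p<..<q}"
  have JI: "J \<subseteq> I" using pq by (simp add: J_def)
  obtain y n where y: "y \<in> \<gamma> ` J" "0 < n" "(f ^^ n) y \<in> \<gamma> ` J"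
    using recurrent_return[OF f order_refl \<open>p < q\<close> order_refl, of 1] unfolding J_def by auto
  obtain t1 t2 where t: "t1 \<in> J" "t2 \<in> J" "(f ^^ n) (\<gamma> t1) = \<gamma> t2" using y by auto
  have "t1 \<in> I" "t2 \<in> I" using t JI by auto
  then have "\<exists>c. (F ^^ n) t1 + c = t2 \<and> (\<forall>x\<in>I. x + c \<in> I \<and> \<gamma> (x + c) = \<gamma> x)"
    using deck[OF lift_iterate(1)[OF F]] lift_iterate(2)[OF F] t(3) by metis
  then obtain c where c: "(F ^^ n) t1 + c = t2" "\<And>x. x \<in> I \<Longrightarrow> x + c \<in> I" "\<And>x. x \<in> I \<Longrightarrow> \<gamma> (x + c) = \<gamma> x"
    by blast
  \<comment> \<open>\<open>(F ^^ n) t1\<close> and \<open>t2\<close> represent the same point.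
    Shifting the lifted iterate by the deck translation gives \<open>G t1 = t2\<close>, so
    \<open>J\<close> and its image under \<open>G\<close> overlap.\<close>
  define G where "G x = (F ^^ n) x + c" for x
  define G' where "G' x = (\<Prod>i<n. F' ((F ^^ i) x))" for x
  have GI: "G x \<in> I" and \<gamma>G: "\<gamma> (G x) = (f ^^ n) (\<gamma> x)" if "x \<in> I" for x
    unfolding G_def using c(2,3) lift_iterate(1,2)[OF F that] by auto
  have dG: "(G has_real_derivative G' x) (at x within I)" if "x \<in> I" for x
  proof -
    have "(G has_real_derivative G' x + 0) (at x within I)"
      unfolding G_def G'_def by (intro DERIV_add lift_iterate(3)[OF F that] DERIV_const)
    then show ?thesis by simp
  qed
  have cG': "continuous_on I G'"
    unfolding G'_def by (rule lift_iterate_continuous(2)[OF F])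
  have GjI: "(G ^^ j) x \<in> I" if "x \<in> I" for x j
    using that by (induction j) (auto intro: GI)
  have \<gamma>Gj: "\<gamma> ((G ^^ j) x) = (f ^^ (n * j)) (\<gamma> x)" if "x \<in> I" for x j
    by (induction j) (use \<gamma>G GjI[OF that] in \<open>auto simp: funpow_add\<close>)
  define K where "K = (\<Union>j. (G ^^ j) ` J)"
  have KI: "K \<subseteq> I" unfolding K_def using GjI JI by blast
  have JK: "J \<subseteq> K"
  proof
    fix x assume "x \<in> J"
    then have "x \<in> (G ^^ 0) ` J" by simp
    then show "x \<in> K" unfolding K_def by blast
  qed
  have GK: "G x \<in> K" if "x \<in> K" for x
  proof -
    obtain j s where "s \<in> J" "x = (G ^^ j) s" using \<open>x \<in> K\<close> unfolding K_def by blast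
    then have "G x \<in> (G ^^ Suc j) ` J" by simp
    then show ?thesis unfolding K_def by (rule UN_I[OF UNIV_I])
  qed
  have "\<gamma> ` K \<noteq> N"
  proof
    assume *: "\<gamma> ` K = N"
    have "\<gamma> ` K \<subseteq> (\<Union>n. (f ^^ n) ` \<gamma> ` J)"
    proof
      fix z assume "z \<in> \<gamma> ` K"
      then obtain j s where s: "s \<in> J" "z = \<gamma> ((G ^^ j) s)" unfolding K_def by blast
      then have "z = (f ^^ (n * j)) (\<gamma> s)" using \<gamma>Gj JI by auto
      then show "z \<in> (\<Union>n. (f ^^ n) ` \<gamma> ` J)" using s(1) by (intro UN_I[of "n * j"]) auto
    qed
    moreover have "(\<Union>n. (f ^^ n) ` \<gamma> ` J) \<subseteq> N"
      using iterate_in[OF fC param_in] subsetD[OF JI] by (intro UN_least image_subsetI; elim imageE; simp)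
    ultimately have "(\<Union>n. (f ^^ n) ` \<gamma> ` J) = N" using * by (intro equalityI) simp_all
    then show False using proper unfolding J_def by simp
  qed
  moreover have conn: "connected K"
  proof -
    have cG: "continuous_on I G"
      using DERIV_continuous[OF dG] by (simp add: continuous_on_eq_continuous_within)
    have cGj: "continuous_on I (G ^^ j)" for j
    proof (induction j)
      case (Suc j)
      have "(G ^^ j) ` I \<subseteq> I" using GjI by (rule image_subsetI)
      then have "continuous_on I (G \<circ> (G ^^ j))"
        by (intro continuous_on_compose Suc continuous_on_subset[OF cG])
      then show ?case by (simp only: funpow.simps)
    qed (simp add: id_def)
    have Gt1: "G t1 = t2" by (simp add: G_def c(1))
    \<comment> \<open>Consecutive images of \<open>J\<close> share the point
      \<open>(G ^^ m) t2 = (G ^^ Suc m) t1\<close>.\<close>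
    have Sm: "connected (\<Union>j\<in>{..m}. (G ^^ j) ` J)" for m
    proof (induction m)
      case 0
      then show ?case by (simp add: J_def)
    next
      case (Suc m)
      have "connected ((G ^^ Suc m) ` J)"
        by (intro connected_continuous_image continuous_on_subset[OF cGj JI]) (simp add: J_def)
      moreover have "(G ^^ m) t2 \<in> (\<Union>j\<in>{..m}. (G ^^ j) ` J)"
        by (rule UN_I[of m]) (simp_all add: t(2))
      moreover have "(G ^^ m) t2 \<in> (G ^^ Suc m) ` J"
      proof (rule image_eqI)
        show "(G ^^ m) t2 = (G ^^ Suc m) t1" by (simp only: funpow_Suc_right o_apply Gt1)
      qed (rule t(1))
      ultimately have "connected ((\<Union>j\<in>{..m}. (G ^^ j) ` J) \<union> (G ^^ Suc m) ` J)"
        by (rule connected_Un[OF Suc _ ne_emptyI[OF IntI]])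
      then show ?case by (simp only: atMost_Suc UN_insert Un_commute)
    qed
    have "K = (\<Union>m. \<Union>j\<in>{..m}. (G ^^ j) ` J)"
    proof
      show "K \<subseteq> (\<Union>m. \<Union>j\<in>{..m}. (G ^^ j) ` J)"
        unfolding K_def by (intro UN_mono order_refl) auto
      show "(\<Union>m. \<Union>j\<in>{..m}. (G ^^ j) ` J) \<subseteq> K"
        unfolding K_def by (intro UN_least UN_upper UNIV_I)
    qed
    moreover have "connected (\<Union>m. \<Union>j\<in>{..m}. (G ^^ j) ` J)"
    proof (rule connected_Union)
      have "t1 \<in> (\<Union>j\<in>{..m}. (G ^^ j) ` J)" for m
        using t(1) by (intro UN_I[of 0]) auto
      then have "t1 \<in> \<Inter> (range (\<lambda>m. \<Union>j\<in>{..m}. (G ^^ j) ` J))" by (intro INT_I)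
      then show "\<Inter> (range (\<lambda>m. \<Union>j\<in>{..m}. (G ^^ j) ` J)) \<noteq> {}" by (rule ne_emptyI)
      fix S assume "S \<in> range (\<lambda>m. \<Union>j\<in>{..m}. (G ^^ j) ` J)"
      then show "connected S" using Sm by (elim rangeE) (simp only:)
    qed
    ultimately show ?thesis by simp
  qed
  ultimately have inj: "inj_on \<gamma> K" using inj_connected[OF KI] by blast
  have nz: "G' x \<noteq> 0" if "x \<in> K" for x
  proof -
    obtain j s where s: "s \<in> J" "x = (G ^^ j) s" using \<open>x \<in> K\<close> unfolding K_def by blast
    have sI: "s \<in> I" "x \<in> I" using s JI GjI by auto
    \<comment> \<open>\<open>x\<close> is an image under \<open>G\<close>, not under
      \<open>F\<close>, but both lifts represent the same orbit on \<open>N\<close>, and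
      \<open>F'\<close> depends only on the represented point.\<close>
    have "F' ((F ^^ i) x) \<noteq> 0" for i
    proof -
      have "\<gamma> ((F ^^ i) x) = (f ^^ (i + n * j)) (\<gamma> s)"
        using lift_iterate(2)[OF F sI(2), of i] \<gamma>Gj[OF sI(1), of j] unfolding s(2)
        by (simp only: funpow_add o_apply)
      also have "\<dots> = \<gamma> ((F ^^ (i + n * j)) s)"
        by (rule lift_iterate(2)[OF F sI(1)])
      finally have "F' ((F ^^ i) x) = F' ((F ^^ (i + n * j)) s)"
        by (rule lift_deriv_eq[OF F lift_iterate(1)[OF F sI(2)] lift_iterate(1)[OF F sI(1)]])
      then show ?thesis using noncrit[of s] s(1) unfolding J_def by simp
    qed
    then show ?thesis unfolding G'_def by simp
  qed
  have sign: "0 < G' x * G' y" if "x \<in> K" "y \<in> K" for x y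
  proof (rule ccontr)
    assume "\<not> 0 < G' x * G' y"
    then have neg: "(G' x < 0 \<and> 0 < G' y) \<or> (G' y < 0 \<and> 0 < G' x)"
      using nz[OF that(1)] nz[OF that(2)] by (metis linorder_neqE_linordered_idom mult_neg_neg mult_pos_pos)
    have "connected (G' ` K)"
      by (intro connected_continuous_image continuous_on_subset[OF cG' KI] conn)
    note between = connectedD_interval[OF this]
    have "0 \<in> G' ` K"
      using neg
    proof
      assume "G' x < 0 \<and> 0 < G' y"
      then show ?thesis using between[OF imageI[OF that(1)] imageI[OF that(2)], of 0] by simp
    next
      assume "G' y < 0 \<and> 0 < G' x"
      then show ?thesis using between[OF imageI[OF that(2)] imageI[OF that(1)], of 0] by simp
    qed
    then show False by (rule imageE) (use nz in simp)
  qed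
  \<comment> \<open>Passing to the square removes a possible reversal of orientation: its derivative
    is a product of two values of \<open>G'\<close>, which have equal sign.\<close>
  define H where "H x = G (G x)" for x
  have HK: "H x \<in> K" if "x \<in> K" for x using GK that by (simp add: H_def)
  have dH: "(H has_real_derivative G' (G x) * G' x) (at x within I)" if "x \<in> I" for x
  proof -
    have "(G has_real_derivative G' (G x)) (at (G x) within G ` I)"
      using dG[OF GI[OF that]] GI by (blast intro: has_field_derivative_subset)
    from DERIV_image_chain[OF this dG[OF that]] show ?thesis
      by (simp add: o_def H_def[abs_def])
  qed
  have cH: "continuous_on I H"
    using DERIV_continuous[OF dH] by (simp add: continuous_on_eq_continuous_within)
  have mono: "H x \<le> H y" if "x \<in> K" "y \<in> K" "x \<le> y" for x y
  proof (cases "x = y")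
    case False
    have sub: "{x..y} \<subseteq> K"
      using connectedD_interval[OF conn that(1,2)] by auto
    have "H x < H y"
    proof (rule DERIV_pos_imp_increasing_open[of x y H])
      show "x < y" using False that by simp
      show "continuous_on {x..y} H"
        using cH sub KI by (meson continuous_on_subset order_trans)
      fix z assume z: "x < z" "z < y"
      have zK: "z \<in> K" using z sub by auto
      have "{x<..<y} \<subseteq> {x..y}" by auto
      then have "{x<..<y} \<subseteq> I" using sub KI by (meson order_trans)
      then have "(H has_real_derivative G' (G z) * G' z) (at z within {x<..<y})"
        by (rule has_field_derivative_subset[OF dH[OF subsetD[OF KI zK]]])
      then have "DERIV H z :> G' (G z) * G' z"
        using z by (subst (asm) at_within_open) auto
      then show "\<exists>d. DERIV H z :> d \<and> 0 < d"
        using sign[OF GK[OF zK] zK] by blast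
    qed
    then show ?thesis by simp
  qed simp
  have HI: "(H ^^ j) x \<in> K" if "x \<in> K" for x j
    using that by (induction j) (auto intro: HK)
  have \<gamma>H: "\<gamma> (H x) = (f ^^ (2 * n)) (\<gamma> x)" if "x \<in> I" for x
    using \<gamma>G[OF GI[OF that]] \<gamma>G[OF that] unfolding H_def
    by (metis funpow_add mult_2 o_apply)
  have \<gamma>Hj: "\<gamma> ((H ^^ j) x) = (f ^^ (2 * n * j)) (\<gamma> x)" if "x \<in> K" for x j
    by (induction j) (use \<gamma>H[OF subsetD[OF KI HI[OF that]]] in \<open>auto simp: funpow_add\<close>)
  have "H t = t" if tJ: "t \<in> J" for t
  proof (rule ccontr)
    assume ne: "H t \<noteq> t"
    have "t \<in> interior I" using tJ interval_interior[OF pq] unfolding J_def by blast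
    moreover from this have "t \<in> I" using interior_subset by blast
    ultimately have "isCont H t"
      using DERIV_continuous[OF dH] at_within_interior by metis
    then obtain d where d: "d > 0" "\<And>s. dist s t < d \<Longrightarrow> dist (H s) (H t) < \<bar>H t - t\<bar> / 2"
      using ne unfolding continuous_at_eps_delta by (metis zero_less_abs_iff half_gt_zero right_minus_eq)
    \<comment> \<open>So small that \<open>H\<close> throws the whole \<open>\<eta>\<close>-interval
      around \<open>t\<close> strictly to one side of it, within the arc still.\<close>
    define \<eta> where "\<eta> = min d (min (\<bar>H t - t\<bar> / 2) (min (t - p) (q - t)))"
    have \<eta>: "\<eta> > 0" "\<eta> \<le> d" "\<eta> \<le> \<bar>H t - t\<bar> / 2" "p \<le> t - \<eta>" "t + \<eta> \<le> q"
    proof -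
      show "\<eta> > 0" using d(1) ne tJ unfolding \<eta>_def J_def by auto
      have "\<eta> \<le> t - p" "\<eta> \<le> q - t"
        unfolding \<eta>_def by (meson min.cobounded1 min.cobounded2 order_trans)+
      then show "p \<le> t - \<eta>" "t + \<eta> \<le> q" by auto
      show "\<eta> \<le> d" "\<eta> \<le> \<bar>H t - t\<bar> / 2"
        unfolding \<eta>_def by (meson min.cobounded1 min.cobounded2 order_trans)+
    qed
    \<comment> \<open>A return time that is a multiple of \<open>2 * n\<close> is a power of
      \<open>H\<close>; by injectivity of \<open>\<gamma>\<close> on \<open>K\<close> it becomes an
      equality of parameters, which monotonicity contradicts.\<close>
    obtain y j where yj: "y \<in> \<gamma> ` {t - \<eta><..<t + \<eta>}" "0 < j"
        "(f ^^ (2 * n * j)) y \<in> \<gamma> ` {t - \<eta><..<t + \<eta>}"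
      using recurrent_return[OF f \<eta>(4) _ \<eta>(5), of "2 * n"] \<eta>(1) y(2) by auto
    obtain s s' where s: "s \<in> {t - \<eta><..<t + \<eta>}" "s' \<in> {t - \<eta><..<t + \<eta>}"
        "(f ^^ (2 * n * j)) (\<gamma> s) = \<gamma> s'"
      using yj by auto
    have sK: "s \<in> K" "s' \<in> K" using s(1,2) \<eta>(4,5) JK unfolding J_def by auto
    have eq: "(H ^^ j) s = s'"
      using inj \<gamma>Hj[OF sK(1)] s(3) HI[OF sK(1)] sK(2) by (metis inj_onD)
    obtain i where i: "j = Suc i" using yj(2) gr0_implies_Suc by blast
    have "\<bar>H s - H t\<bar> < \<bar>H t - t\<bar> / 2"
      using d(2)[of s] s(1) \<eta>(2) by (auto simp: dist_real_def)
    then have near: "H s < H t + \<bar>H t - t\<bar> / 2" "H t - \<bar>H t - t\<bar> / 2 < H s"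
      unfolding abs_less_iff by linarith+
    show False
    proof (cases "H t > t")
      case True
      then have "H s > t + \<eta>" using near(2) \<eta>(3) by (simp add: field_simps)
      moreover have "s \<le> H s" using calculation s(1) by auto
      then have "H s \<le> s'" using iterate_monotone_above[where H = H, OF HK mono sK(1), of i] eq i by simp
      ultimately show False using s(2) by auto
    next
      case False
      then have "H s < t - \<eta>" using near(1) \<eta>(3) ne by (simp add: field_simps)
      moreover have "H s \<le> s" using calculation s(1) by auto
      then have "s' \<le> H s" using iterate_monotone_below[where H = H, OF HK mono sK(1), of i] eq i by simp
      ultimately show False using s(2) by auto
    qed
  qed
  then have "(f ^^ (2 * n)) (\<gamma> t) = \<gamma> t" if "t \<in> J" for t
    using \<gamma>H[of t] that JI by auto
  then show ?thesis using y(2) unfolding J_def by (intro exI[of _ "2 * n"]) auto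
qed

text \<open>Near a point \<open>t0\<close> of maximal period \<open>n\<close> the iterate
  \<open>f ^^ n\<close> is the identity. Replacing \<open>F t\<close> by a convex combination with
  \<open>F t0\<close> has the same effect on the first step as moving \<open>t\<close> closer to
  \<open>t0\<close>, and the remaining \<open>n - 1\<close> steps are unperturbed, so
  \<open>t0\<close> becomes attracting.\<close>

lemma periodic_traps:
  assumes fC: "f \<in> C1" and "p < q" and pq: "{p<..<q} \<subseteq> I" and F: "lift f F F'" and e: "0 < e"
    and P: "0 < P" "\<And>t. t \<in> {p<..<q} \<Longrightarrow> (f ^^ P) (\<gamma> t) = \<gamma> t"
  shows "\<exists>g\<in>C1. near e f g \<and> traps g p q"
proof -
  define J where "J = {p<..<q}"
  define per where "per t = (LEAST n. 0 < n \<and> (f ^^ n) (\<gamma> t) = \<gamma> t)" for t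
  have per: "0 < per t" "(f ^^ per t) (\<gamma> t) = \<gamma> t" "per t \<le> P" if "t \<in> J" for t
  proof -
    have ex: "0 < P \<and> (f ^^ P) (\<gamma> t) = \<gamma> t" using P that unfolding J_def by simp
    show "0 < per t" "(f ^^ per t) (\<gamma> t) = \<gamma> t"
      using LeastI[of "\<lambda>n. 0 < n \<and> (f ^^ n) (\<gamma> t) = \<gamma> t", OF ex] unfolding per_def by simp_all
    show "per t \<le> P" unfolding per_def by (rule Least_le[of "\<lambda>n. 0 < n \<and> (f ^^ n) (\<gamma> t) = \<gamma> t", OF ex])
  qed
  have per_min: "(f ^^ i) (\<gamma> t) \<noteq> \<gamma> t" if "0 < i" "i < per t" for i t
    using not_less_Least[of i "\<lambda>n. 0 < n \<and> (f ^^ n) (\<gamma> t) = \<gamma> t"] that unfolding per_def by simp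
  obtain m where "m \<in> J" using \<open>p < q\<close> dense unfolding J_def by (metis greaterThanLessThan_iff)
  moreover have "\<forall>t. t \<in> J \<longrightarrow> per t < Suc P" using per(3) by (simp add: le_imp_less_Suc)
  ultimately have "\<exists>t. t \<in> J \<and> (\<forall>y. y \<in> J \<longrightarrow> per y \<le> per t)"
    by (rule ex_has_greatest_nat)
  then obtain t0 where t0: "t0 \<in> J" "\<And>t. t \<in> J \<Longrightarrow> per t \<le> per t0" by auto
  \<comment> \<open>the minimal period is lower semicontinuous, hence constant near a point where it is maximal\<close>
  define n where "n = per t0"
  define x0 where "x0 = \<gamma> t0"
  have n: "0 < n" "(f ^^ n) x0 = x0" "\<And>i. 0 < i \<Longrightarrow> i < n \<Longrightarrow> (f ^^ i) x0 \<noteq> x0"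
    using per(1,2)[OF t0(1)] per_min unfolding n_def x0_def by auto
  have t0I: "t0 \<in> interior I" "t0 \<in> I"
    using t0(1) pq interval_interior[OF pq] unfolding J_def by auto
  have x0N: "x0 \<in> N" unfolding x0_def by (rule param_in[OF t0I(2)])
  \<comment> \<open>At most half the distance from \<open>x0\<close> to any other point of its
    cycle; the entry 1 keeps the minimum meaningful when \<open>n = 1\<close>.\<close>
  define d where "d = Min ({1} \<union> (\<lambda>i. dist ((f ^^ i) x0) x0 / 2) ` {0<..<n})"
  have d: "0 < d"
    unfolding d_def using n(3) by (subst Min_gr_iff) auto
  have d_less: "d < dist ((f ^^ i) x0) x0" if "0 < i" "i < n" for i
  proof -
    have "d \<le> dist ((f ^^ i) x0) x0 / 2"
      unfolding d_def using that by (intro Min_le) auto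
    then show ?thesis using n(3)[OF that] zero_less_dist_iff[of "(f ^^ i) x0" x0] by linarith
  qed
  have "\<forall>\<^sub>F s in nhds t0. s \<in> J \<and> (f ^^ 0) (\<gamma> s) \<in> N \<inter> ball x0 d \<and>
      (\<forall>i\<in>{0<..<n}. (f ^^ i) (\<gamma> s) \<in> N - cball x0 d)"
  proof (intro eventually_conj eventually_ball_finite ballI)
    show "\<forall>\<^sub>F s in nhds t0. s \<in> J"
      using eventually_nhds_in_open[OF open_greaterThanLessThan, of t0 p q] t0(1) unfolding J_def by simp
    show "\<forall>\<^sub>F s in nhds t0. (f ^^ 0) (\<gamma> s) \<in> N \<inter> ball x0 d"
      using x0N d by (intro eventually_iterate_param[OF fC t0I(1)] openin_open_Int) (simp_all add: x0_def)
    show "\<forall>\<^sub>F s in nhds t0. (f ^^ i) (\<gamma> s) \<in> N - cball x0 d" if "i \<in> {0<..<n}" for i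
      using iterate_in[OF fC x0N, of i] d_less[of i] that
      by (intro eventually_iterate_param[OF fC t0I(1)] openin_diff_closed closed_cball)
        (simp add: x0_def dist_commute)
  qed simp
  then obtain \<rho> where \<rho>: "0 < \<rho>" "\<And>s. dist s t0 < \<rho> \<Longrightarrow> s \<in> J \<and> (f ^^ 0) (\<gamma> s) \<in> N \<inter> ball x0 d \<and>
      (\<forall>i\<in>{0<..<n}. (f ^^ i) (\<gamma> s) \<in> N - cball x0 d)"
    unfolding eventually_nhds_metric by (elim exE conjE) (rule that, assumption, simp)
  have \<rho>J: "s \<in> J" and \<rho>0: "\<gamma> s \<in> ball x0 d"
    and \<rho>i: "\<And>i. 0 < i \<Longrightarrow> i < n \<Longrightarrow> (f ^^ i) (\<gamma> s) \<notin> cball x0 d" if "\<bar>s - t0\<bar> < \<rho>" for s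
    using \<rho>(2)[of s] that by (simp_all add: dist_real_def)
  \<comment> \<open>A period below \<open>n\<close> would bring the point back into the ball before
    time \<open>n\<close>; a period above \<open>n\<close> is excluded by maximality.\<close>
  have fn: "(f ^^ n) (\<gamma> s) = \<gamma> s" if "\<bar>s - t0\<bar> < \<rho>" for s
  proof -
    have "\<not> per s < n"
    proof
      assume "per s < n"
      then have "(f ^^ per s) (\<gamma> s) \<notin> cball x0 d"
        by (intro \<rho>i[OF that] per(1)[OF \<rho>J[OF that]])
      then show False using per(2)[OF \<rho>J[OF that]] \<rho>0[OF that] by (simp add: less_imp_le)
    qed
    then have "per s = n" using t0(2)[OF \<rho>J[OF that]] unfolding n_def by simp
    then show ?thesis using per(2)[OF \<rho>J[OF that]] by simp
  qed
  obtain \<kappa> where \<kappa>: "\<kappa> > 0" and pert: "\<forall>\<tau>\<in>I. \<forall>\<delta> s. \<forall>V\<in>I. 0 < \<delta> \<longrightarrow> \<delta> \<le> 1 \<longrightarrow> 2 * \<delta> < w \<longrightarrow> 0 \<le> s \<longrightarrow> s \<le> 1 \<longrightarrow>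
    (\<forall>t\<in>I. \<bar>t - \<tau>\<bar> < \<delta> \<longrightarrow> s * \<bar>V - F t\<bar> \<le> \<kappa> * \<delta> \<and> s * \<bar>F' t\<bar> \<le> \<kappa>) \<longrightarrow>
    (\<exists>g\<in>C1. near e f g \<and> (\<forall>t\<in>I. \<bar>t - \<tau>\<bar> \<le> \<delta> / 2 \<longrightarrow> g (\<gamma> t) = \<gamma> (F t + s * (V - F t))) \<and>
       (\<forall>x\<in>N - \<gamma> ` (I \<inter> ball \<tau> \<delta>). g x = f x))"
    using perturb_towards[OF fC F e] by (elim exE conjE) (rule that)
  define \<delta> where "\<delta> = min 1 (min (w / 3) \<rho>)"
  have \<delta>: "0 < \<delta>" "\<delta> \<le> 1" "2 * \<delta> < w" "\<delta> \<le> \<rho>"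
    using w_pos \<rho>(1) unfolding \<delta>_def by linarith+
  have \<delta>I: "t \<in> I" if "\<bar>t - t0\<bar> < \<delta>" for t
    using subsetD[OF pq] \<rho>J[of t] that \<delta>(4) unfolding J_def by simp
  have "continuous_on I (\<lambda>t. (F t0 - F t, F' t))"
    by (intro continuous_on_Pair continuous_on_diff continuous_on_const
        lift_continuous[OF F] lift_continuous_deriv[OF F])
  from compact_continuous_image[OF continuous_on_subset[OF this Int_lower1]
      closed_Int_compact[OF closed_I compact_cball]]
  have "compact ((\<lambda>t. (F t0 - F t, F' t)) ` (I \<inter> cball t0 \<delta>))" .
  from compact_imp_bounded[OF this] obtain B where B0: "0 < B"
      "\<forall>z\<in>(\<lambda>t. (F t0 - F t, F' t)) ` (I \<inter> cball t0 \<delta>). norm z \<le> B"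
    unfolding bounded_pos by (elim exE conjE) (rule that)
  have B: "0 < B" "\<And>t. t \<in> I \<inter> cball t0 \<delta> \<Longrightarrow> norm (F t0 - F t, F' t) \<le> B"
    using B0 by simp_all
  have B1: "\<bar>F t0 - F t\<bar> \<le> B" "\<bar>F' t\<bar> \<le> B" if "t \<in> I" "\<bar>t - t0\<bar> < \<delta>" for t
  proof -
    have "t \<in> I \<inter> cball t0 \<delta>" using that by (simp add: dist_real_def abs_minus_commute)
    from order_trans[OF norm_fst_le B(2)[OF this]] order_trans[OF norm_snd_le B(2)[OF this]]
    show "\<bar>F t0 - F t\<bar> \<le> B" "\<bar>F' t\<bar> \<le> B" by simp_all
  qed
  \<comment> \<open>\<open>B\<close> bounds both the displacement towards \<open>F t0\<close> and
    \<open>F'\<close>, so the second entry makes the pull admissible for \<open>pert\<close>, as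
    \<open>\<delta> \<le> 1\<close>. The cap 1/2 keeps \<open>s\<close> below 1.\<close>
  define s where "s = min (1/2) (\<kappa> * \<delta> / B)"
  have s: "0 < s" "s < 1" "s * B \<le> \<kappa> * \<delta>"
  proof -
    show "0 < s" "s < 1" using \<kappa> \<delta>(1) B(1) unfolding s_def by auto
    have "s * B \<le> \<kappa> * \<delta> / B * B" using B(1) unfolding s_def by (intro mult_right_mono) auto
    then show "s * B \<le> \<kappa> * \<delta>" using B(1) by simp
  qed
  have bound: "\<forall>t\<in>I. \<bar>t - t0\<bar> < \<delta> \<longrightarrow> s * \<bar>F t0 - F t\<bar> \<le> \<kappa> * \<delta> \<and> s * \<bar>F' t\<bar> \<le> \<kappa>"
  proof (intro ballI impI conjI)
    fix t assume t: "t \<in> I" "\<bar>t - t0\<bar> < \<delta>"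
    show "s * \<bar>F t0 - F t\<bar> \<le> \<kappa> * \<delta>"
      using mult_left_mono[OF B1(1)[OF t], of s] s by linarith
    have "\<kappa> * \<delta> \<le> \<kappa>" using \<kappa> \<delta>(2) by simp
    then show "s * \<bar>F' t\<bar> \<le> \<kappa>"
      using mult_left_mono[OF B1(2)[OF t], of s] s by linarith
  qed
  have "\<exists>g\<in>C1. near e f g \<and>
      (\<forall>t\<in>I. \<bar>t - t0\<bar> \<le> \<delta> / 2 \<longrightarrow> g (\<gamma> t) = \<gamma> (F t + s * (F t0 - F t))) \<and>
      (\<forall>x\<in>N - \<gamma> ` (I \<inter> ball t0 \<delta>). g x = f x)"
    using bound t0I(2) lift_into[OF F t0I(2)] \<delta>(1,2,3) s(1,2)
    by (intro pert[THEN bspec, THEN spec, THEN spec, THEN bspec, THEN mp, THEN mp, THEN mp, THEN mp, THEN mp, THEN mp]) simp_all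
  then obtain g where g: "g \<in> C1" "near e f g"
      "\<forall>t\<in>I. \<bar>t - t0\<bar> \<le> \<delta> / 2 \<longrightarrow> g (\<gamma> t) = \<gamma> (F t + s * (F t0 - F t))"
      "\<forall>x\<in>N - \<gamma> ` (I \<inter> ball t0 \<delta>). g x = f x"
    by (elim bexE conjE) (rule that)
  have g_off: "g x = f x" if "x \<in> N" "x \<notin> ball x0 d" for x
  proof -
    have "\<gamma> ` (I \<inter> ball t0 \<delta>) \<subseteq> ball x0 d"
    proof
      fix y assume "y \<in> \<gamma> ` (I \<inter> ball t0 \<delta>)"
      then obtain t where "y = \<gamma> t" "\<bar>t - t0\<bar> < \<delta>" by (auto simp: dist_real_def abs_minus_commute)
      then show "y \<in> ball x0 d" using \<rho>0[of t] \<delta>(4) by simp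
    qed
    then show ?thesis using g(4) that by blast
  qed
  \<comment> \<open>Intermediate value theorem: the value pulled towards \<open>F t0\<close> is
    attained by \<open>F\<close> at some \<open>y\<close> between \<open>t0\<close> and
    \<open>t\<close>. If \<open>F t \<noteq> F t0\<close> then \<open>y\<close> differs from
    \<open>t\<close> because \<open>s > 0\<close>; otherwise \<open>y = t0\<close> serves.\<close>
  have \<psi>: "\<exists>y. \<bar>y - t0\<bar> \<le> \<bar>t - t0\<bar> \<and> (t \<noteq> t0 \<longrightarrow> \<bar>y - t0\<bar> < \<bar>t - t0\<bar>) \<and> F y = F t + s * (F t0 - F t)"
    if t: "\<bar>t - t0\<bar> \<le> \<delta> / 2" for t
  proof (cases "F t = F t0")
    case True
    then show ?thesis by (intro exI[of _ t0]) simp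
  next
    case False
    have seg: "closed_segment t0 t \<subseteq> I"
      using \<delta>I[of t] t \<delta>(1) t0I(2) by (intro closed_segment_subset convex_I) auto
    have "connected (F ` closed_segment t0 t)"
      by (intro connected_continuous_image continuous_on_subset[OF lift_continuous[OF F] seg] connected_segment)
    then have "convex (F ` closed_segment t0 t)" using is_interval_connected_1 is_interval_convex_1 by blast
    then have "(1 - s) *\<^sub>R F t + s *\<^sub>R F t0 \<in> F ` closed_segment t0 t"
      using s(1,2) by (intro convexD) auto
    then obtain y where y: "y \<in> closed_segment t0 t" "F y = (1 - s) *\<^sub>R F t + s *\<^sub>R F t0"
      by (metis imageE)
    have Fy: "F y = F t + s * (F t0 - F t)" using y(2) by (simp add: algebra_simps)
    have "y \<noteq> t"
    proof
      assume "y = t"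
      then have "s * (F t0 - F t) = 0" using Fy by simp
      then show False using s(1) False by simp
    qed
    moreover have "\<bar>y - t0\<bar> \<le> \<bar>t - t0\<bar>" "\<bar>y - t0\<bar> = \<bar>t - t0\<bar> \<longrightarrow> y = t"
      using y(1) by (auto simp: closed_segment_eq_real_ivl split: if_splits)
    ultimately show ?thesis using Fy by (intro exI[of _ y]) linarith
  qed
  have iter: "\<exists>y. \<bar>y - t0\<bar> \<le> \<bar>t - t0\<bar> \<and> (t \<noteq> t0 \<longrightarrow> \<bar>y - t0\<bar> < \<bar>t - t0\<bar>) \<and>
      (g ^^ n) (\<gamma> t) = \<gamma> y \<and> (\<forall>i. 0 < i \<longrightarrow> i < n \<longrightarrow> (g ^^ i) (\<gamma> t) \<notin> cball x0 d)"
    if t: "\<bar>t - t0\<bar> \<le> \<delta> / 2" for t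
  proof -
    obtain y where y: "\<bar>y - t0\<bar> \<le> \<bar>t - t0\<bar>" "t \<noteq> t0 \<longrightarrow> \<bar>y - t0\<bar> < \<bar>t - t0\<bar>"
      "F y = F t + s * (F t0 - F t)" using \<psi>[OF t] by (elim exE conjE) (rule that)
    have tI: "t \<in> I" using \<delta>I[of t] t \<delta>(1) by simp
    have yd: "\<bar>y - t0\<bar> < \<delta>" using y(1) t \<delta>(1) by linarith
    have yI: "y \<in> I" by (rule \<delta>I[OF yd])
    have y\<rho>: "\<bar>y - t0\<bar> < \<rho>" using yd \<delta>(4) by simp
    \<comment> \<open>From the first step on, the \<open>g\<close>-orbit of
      \<open>\<gamma> t\<close> is the \<open>f\<close>-orbit of \<open>\<gamma> y\<close>, since
      the points at times 1 to \<open>n - 1\<close> lie outside the ball containing the support of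
      the perturbation.\<close>
    have step: "(g ^^ Suc i) (\<gamma> t) = (f ^^ Suc i) (\<gamma> y)" if "i < n" for i
      using that
    proof (induction i)
      case 0
      have "g (\<gamma> t) = \<gamma> (F y)" using g(3) tI t y(3) by simp
      then show ?case using lift_eq[OF F yI] by simp
    next
      case (Suc i)
      have "(f ^^ Suc i) (\<gamma> y) \<notin> ball x0 d"
        using \<rho>i[OF y\<rho>, of "Suc i"] Suc.prems ball_subset_cball by blast
      then have "g ((f ^^ Suc i) (\<gamma> y)) = f ((f ^^ Suc i) (\<gamma> y))"
        by (rule g_off[OF iterate_in[OF fC param_in[OF yI]]])
      then show ?case using Suc by simp
    qed
    have pos: "(g ^^ i) (\<gamma> t) = (f ^^ i) (\<gamma> y)" if "0 < i" "i \<le> n" for i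
      using step[of "i - 1"] that by simp
    have "(g ^^ n) (\<gamma> t) = \<gamma> y"
      using pos[OF n(1) order_refl] fn[OF y\<rho>] by simp
    moreover have "(g ^^ i) (\<gamma> t) \<notin> cball x0 d" if "0 < i" "i < n" for i
      using pos[of i] \<rho>i[OF y\<rho>] that by simp
    ultimately show ?thesis using y(1,2) by (intro exI[of _ y] conjI allI impI) simp_all
  qed
  define r where "r = \<delta> / 4"
  have r: "0 < r" "r < \<delta> / 2" using \<delta>(1) unfolding r_def by auto
  define C where "C = \<gamma> ` (I \<inter> cball t0 r)"
  define U where "U = \<gamma> ` (I \<inter> ball t0 r)"
  have gC: "(g ^^ n) (\<gamma> t) \<in> U" if t: "\<bar>t - t0\<bar> \<le> r" for t
  proof -
    have t2: "\<bar>t - t0\<bar> \<le> \<delta> / 2" using t r(2) by linarith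
    obtain y where y: "\<bar>y - t0\<bar> \<le> \<bar>t - t0\<bar>" "t \<noteq> t0 \<longrightarrow> \<bar>y - t0\<bar> < \<bar>t - t0\<bar>"
      "(g ^^ n) (\<gamma> t) = \<gamma> y" using iter[OF t2] by (elim exE conjE) (rule that)
    have "\<bar>y - t0\<bar> < r" using y(1,2) t r(1) by (cases "t = t0") auto
    moreover from this have "y \<in> I" using \<delta>I[of y] r(2) \<delta>(1) by simp
    ultimately show ?thesis
      unfolding U_def y(3) by (intro imageI) (simp add: dist_real_def abs_minus_commute)
  qed
  have Uo: "openin (top_of_set N) U" unfolding U_def by (intro openin_param open_ball)
  have tr: "t0 + r \<in> interior I"
  proof -
    have "t0 + r \<in> J" using \<rho>J[of "t0 + r"] r \<delta>(1,4) by simp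
    then show ?thesis using interval_interior[OF pq] unfolding J_def by blast
  qed
  have "(g ^^ n) (\<gamma> (t0 + r)) \<in> U" using gC[of "t0 + r"] r(1) by simp
  from eventually_iterate_param[OF g(1) tr Uo this]
  obtain h where h: "0 < h" "\<And>t. dist t (t0 + r) < h \<Longrightarrow> (g ^^ n) (\<gamma> t) \<in> U"
    unfolding eventually_nhds_metric by blast
  \<comment> \<open>The witness lies just outside \<open>C\<close>, beyond the end point
    \<open>t0 + r\<close>. That end point is mapped into the open set \<open>U\<close>, hence so are
    nearby points.\<close>
  define x where "x = t0 + r + min (h / 2) (\<delta> / 4)"
  have x: "r < \<bar>x - t0\<bar>" "\<bar>x - t0\<bar> \<le> \<delta> / 2" "dist x (t0 + r) < h"
    using r(1) h(1) \<delta>(1) unfolding x_def dist_real_def by (auto simp: r_def min_def)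
  have x\<delta>: "\<bar>x - t0\<bar> < \<delta>" using x(2) \<delta>(1) by linarith
  have xI: "x \<in> I" by (rule \<delta>I[OF x\<delta>])
  have "traps g p q"
    unfolding traps_def
  proof (intro exI conjI allI impI)
    show "0 < n" by (rule n(1))
    have "compact (I \<inter> cball t0 r)" by (intro closed_Int_compact closed_I compact_cball)
    then show "compact C"
      unfolding C_def by (intro compact_continuous_image continuous_on_subset[OF continuous_param]) simp_all
    show "C \<subseteq> N" using image_eq unfolding C_def by blast
    show "U \<subseteq> C" unfolding C_def U_def by (intro image_mono Int_mono ball_subset_cball order_refl)
    show "openin (top_of_set N) U" by (rule Uo)
    show "(g ^^ n) ` C \<subseteq> U"
      using gC unfolding C_def by (auto simp: dist_real_def abs_minus_commute)
    show "(g ^^ n) (\<gamma> x) \<in> U" by (rule h(2)[OF x(3)])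
    have "x \<in> J" using \<rho>J[of x] x\<delta> \<delta>(4) by simp
    then show "\<gamma> x \<in> \<gamma> ` {p<..<q}" unfolding J_def by (rule imageI)
    fix i assume "i < n"
    \<comment> \<open>At time 0 the parameter separates the point from \<open>C\<close>; at times 1
      to \<open>n - 1\<close> the images of \<open>C\<close> avoid the ball around \<open>x0\<close>
      that contains the point.\<close>
    show "\<gamma> x \<notin> (g ^^ i) ` C"
    proof
      assume "\<gamma> x \<in> (g ^^ i) ` C"
      then obtain t where t: "t \<in> I" "\<bar>t - t0\<bar> \<le> r" "\<gamma> x = (g ^^ i) (\<gamma> t)"
        unfolding C_def by (auto simp: dist_real_def abs_minus_commute)
      show False
      proof (cases "i = 0")
        case True
        have "\<bar>x - t\<bar> < w" using x(2) t(2) r(2) \<delta>(3) by linarith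
        then have "x = t" using inj_short[OF xI t(1)] t(3) True by simp
        then show False using x(1) t(2) by simp
      next
        case False
        have "\<bar>t - t0\<bar> \<le> \<delta> / 2" using t(2) r(2) by linarith
        then have "\<gamma> x \<notin> cball x0 d" using iter[of t] False \<open>i < n\<close> t(3) by auto
        moreover have "\<gamma> x \<in> ball x0 d" using \<rho>0[of x] x\<delta> \<delta>(4) by simp
        ultimately show False by simp
      qed
    qed
  qed
  then show ?thesis using g(1,2) by blast
qed

lemma approximable_by_traps:
  assumes "f \<in> everywhere_recurrent p q" "p < q" "{p<..<q} \<subseteq> I" "0 < e"
    and "(\<Union>n. (f ^^ n) ` \<gamma> ` {p<..<q}) \<noteq> N"
  shows "\<exists>g\<in>C1. near e f g \<and> traps g p q"
proof -
  have fC: "f \<in> C1" using assms(1) unfolding everywhere_recurrent_def by blast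
  obtain F F' where F: "lift f F F'" using lift_exists[OF fC] by blast
  show ?thesis
  proof (cases "\<exists>t\<in>{p<..<q}. \<exists>n. F' ((F ^^ n) t) = 0")
    case True
    then obtain t n where "t \<in> {p<..<q}" "F' ((F ^^ n) t) = 0" by blast
    then show ?thesis by (rule critical_traps[OF assms(1,3) F _ _ assms(4)])
  next
    case False
    then have "F' ((F ^^ n) t) \<noteq> 0" if "t \<in> {p<..<q}" for t n using that by blast
    from noncritical_periodic[OF assms(1-3) F this assms(5)]
    obtain P where "0 < P" "\<And>t. t \<in> {p<..<q} \<Longrightarrow> (f ^^ P) (\<gamma> t) = \<gamma> t" by blast
    then show ?thesis by (rule periodic_traps[OF fC assms(2,3) F assms(4)])
  qed
qed


section \<open>Attractors of generic maps\<close>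

lemma omega_limit_avoids:
  assumes fC: "f \<in> C1" and D: "openin (top_of_set N) D" and "\<not> recurs f D" and x: "x \<in> N"
  shows "omega_limit f x \<inter> D = {}"
proof (rule ccontr)
  assume "omega_limit f x \<inter> D \<noteq> {}"
  then obtain y where y: "y \<in> omega_limit f x" "y \<in> D" by auto
  obtain r :: "nat \<Rightarrow> nat" where r: "strict_mono r" "(\<lambda>n. (f ^^ r n) x) \<longlonglongrightarrow> y"
    using y(1) unfolding omega_limit_def by auto
  obtain S where S: "open S" "D = N \<inter> S" using D openin_open by metis
  have "\<forall>\<^sub>F n in sequentially. (f ^^ r n) x \<in> S"
    using topological_tendstoD[OF r(2) S(1)] y(2) S(2) by simp
  then obtain M where M: "\<And>n. M \<le> n \<Longrightarrow> (f ^^ r n) x \<in> S"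
    unfolding eventually_sequentially by auto
  have "r ` {M..} \<subseteq> {n. (f ^^ n) x \<in> D}"
    using M iterate_in[OF fC x] S(2) by auto
  moreover have "infinite (r ` {M..})"
    using finite_imageD[of r "{M..}"] strict_mono_imp_inj_on[OF r(1)] infinite_Ici inj_on_subset by blast
  ultimately have "infinite {n. (f ^^ n) x \<in> D}" using finite_subset by metis
  then show False using assms(3) x unfolding recurs_def by auto
qed

lemma omega_limit_invariant:
  assumes fC: "f \<in> C1" and x: "x \<in> N" and y: "y \<in> omega_limit f x"
  shows "f y \<in> omega_limit f x"
proof -
  obtain r :: "nat \<Rightarrow> nat" where r: "strict_mono r" "(\<lambda>n. (f ^^ r n) x) \<longlonglongrightarrow> y"
    using y unfolding omega_limit_def by auto
  have "omega_limit f x \<subseteq> N"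
    using C1_into[OF fC] by (intro omega_limit_subset compact_imp_closed compact_N x) auto
  then have "y \<in> N" using y by auto
  have "(\<lambda>n. f ((f ^^ r n) x)) \<longlonglongrightarrow> f y"
    by (rule continuous_on_tendsto_compose[OF C1_continuous[OF fC] r(2) \<open>y \<in> N\<close>])
      (simp add: iterate_in[OF fC x])
  then have "(\<lambda>n. (f ^^ (Suc (r n))) x) \<longlonglongrightarrow> f y" by simp
  moreover have "strict_mono (\<lambda>n. Suc (r n))" using r(1) by (simp add: strict_mono_def)
  ultimately show ?thesis unfolding omega_limit_def by auto
qed

text \<open>The only features of the two attractors that matter: minimality is tested on sets \<open>B\<close> that
  capture every limit set captured by \<open>A\<close>.\<close>

definition attractor_like :: "('a \<Rightarrow> 'a) \<Rightarrow> 'a set \<Rightarrow> bool" where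
  "attractor_like f A \<longleftrightarrow> closedin (top_of_set N) A \<and>
     (\<forall>B. closedin (top_of_set N) B \<longrightarrow>
        (\<forall>x\<in>N. omega_limit f x \<subseteq> A \<longrightarrow> omega_limit f x \<subseteq> B) \<longrightarrow> A \<subseteq> B)"

lemma milnor_attractor_like:
  assumes "f \<in> C1" "space \<mu> = N"
  shows "attractor_like f (milnor_attractor N \<mu> f)"
proof -
  have fN: "f ` N \<subseteq> N" using C1_into[OF assms(1)] by auto
  note L = milnor_attractor_least[OF compact_imp_closed[OF compact_N] fN assms(2)]
  show ?thesis
    unfolding attractor_like_def
  proof (intro conjI allI impI)
    show "closedin (top_of_set N) (milnor_attractor N \<mu> f)" by (rule L(1))
    fix B assume B: "closedin (top_of_set N) B"
      "\<forall>x\<in>N. omega_limit f x \<subseteq> milnor_attractor N \<mu> f \<longrightarrow> omega_limit f x \<subseteq> B"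
    have "AE x in \<mu>. omega_limit f x \<subseteq> B"
      using L(2) by (rule AE_mp) (rule AE_I2, use B(2) assms(2) in simp)
    then show "milnor_attractor N \<mu> f \<subseteq> B" by (rule L(3)[OF B(1)])
  qed
qed

lemma generic_limit_set_attractor_like:
  assumes "f \<in> C1"
  shows "attractor_like f (generic_limit_set N f)"
proof -
  have fN: "f ` N \<subseteq> N" using C1_into[OF assms(1)] by auto
  note L = generic_limit_set_least[OF compact_imp_closed[OF compact_N] fN]
  show ?thesis
    unfolding attractor_like_def
  proof (intro conjI allI impI)
    show "closedin (top_of_set N) (generic_limit_set N f)" by (rule L(1))
    fix B assume B: "closedin (top_of_set N) B"
      "\<forall>x\<in>N. omega_limit f x \<subseteq> generic_limit_set N f \<longrightarrow> omega_limit f x \<subseteq> B"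
    obtain R where R: "residual_in (top_of_set N) R" "\<forall>x\<in>R. omega_limit f x \<subseteq> generic_limit_set N f"
      using L(2) by auto
    have "R \<subseteq> N" using R(1) unfolding residual_in_def by simp
    then have "\<forall>x\<in>R. omega_limit f x \<subseteq> B" using B(2) R(2) by (metis subsetD)
    then show "generic_limit_set N f \<subseteq> B" by (rule L(3)[OF B(1) R(1)])
  qed
qed

text \<open>If no orbit visited some subarc infinitely often, no limit set would meet that subarc,
  and deleting it from \<open>A\<close> would leave a smaller closed competitor.\<close>

lemma attractor_like_recurrent:
  assumes fC: "f \<in> C1" and A: "attractor_like f A" and pq: "{p<..<q} \<subseteq> I" "\<gamma> ` {p<..<q} \<subseteq> A"
  shows "f \<in> everywhere_recurrent p q"
  unfolding everywhere_recurrent_def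
proof (intro CollectI conjI allI impI fC)
  fix r s assume rs: "p \<le> r" "r < s" "s \<le> q"
  define J where "J = {r<..<s}"
  have Jpq: "J \<subseteq> {p<..<q}" unfolding J_def using rs by auto
  have JI: "I \<inter> J = J" using Jpq pq(1) by blast
  have D: "openin (top_of_set N) (\<gamma> ` J)"
    using openin_param[of J] unfolding JI by (simp add: J_def)
  show "recurs f (\<gamma> ` {r<..<s})"
  proof (rule ccontr)
    assume "\<not> recurs f (\<gamma> ` {r<..<s})"
    then have avoid: "omega_limit f x \<inter> \<gamma> ` J = {}" if "x \<in> N" for x
      using omega_limit_avoids[OF fC D _ that] unfolding J_def by simp
    have "closedin (top_of_set N) (A - \<gamma> ` J)"
      using A D unfolding attractor_like_def by (intro closedin_diff) simp_all
    moreover have "omega_limit f x \<subseteq> A - \<gamma> ` J" if "x \<in> N" "omega_limit f x \<subseteq> A" for x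
      using avoid[OF that(1)] that(2) by blast
    ultimately have "A \<subseteq> A - \<gamma> ` J" using A unfolding attractor_like_def by metis
    moreover have "\<gamma> ` J \<subseteq> A" using pq(2) Jpq by (meson image_mono order_trans)
    ultimately have "\<gamma> ` J = {}" by blast
    then have "J = {}" by simp
    then show False using rs(2) unfolding J_def by simp
  qed
qed

text \<open>Limit sets are forward invariant, so those contained in \<open>A\<close> are also
  contained in the closed set of points of \<open>A\<close> whose image is in \<open>A\<close>;
  minimality of \<open>A\<close> applies to that set.\<close>

lemma attractor_like_forward_invariant:
  assumes fC: "f \<in> C1" and A: "attractor_like f A"
  shows "f ` A \<subseteq> A"
proof -
  have cA: "closedin (top_of_set N) A" using A unfolding attractor_like_def by simp
  have AN: "A \<subseteq> N" using closedin_subset[OF cA] by simp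
  define B where "B = A \<inter> (N \<inter> f -` A)"
  have "closedin (top_of_set N) (N \<inter> f -` A)"
    using C1_into[OF fC] by (intro continuous_closedin_preimage_gen[OF C1_continuous[OF fC] _ cA]) auto
  then have "closedin (top_of_set N) B" unfolding B_def by (rule closedin_Int[OF cA])
  moreover have "omega_limit f x \<subseteq> B" if "x \<in> N" "omega_limit f x \<subseteq> A" for x
  proof
    fix y assume y: "y \<in> omega_limit f x"
    then have "f y \<in> A" using omega_limit_invariant[OF fC that(1)] that(2) by auto
    then show "y \<in> B" unfolding B_def using y that(2) AN by auto
  qed
  ultimately have "A \<subseteq> B" using A unfolding attractor_like_def by metis
  then show ?thesis unfolding B_def by auto
qed

lemma attractor_like_orbit:
  assumes "f \<in> C1" "attractor_like f A" "S \<subseteq> A"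
  shows "(\<Union>n. (f ^^ n) ` S) \<subseteq> A"
proof -
  have "(f ^^ n) x \<in> A" if "x \<in> A" for n x
    by (induction n) (use that attractor_like_forward_invariant[OF assms(1,2)] in auto)
  then show ?thesis using assms(3) by auto
qed

text \<open>The interior, in the C1 topology, of the complement of
  \<open>everywhere_recurrent p q\<close>.\<close>

definition robustly_wandering :: "real \<Rightarrow> real \<Rightarrow> ('a \<Rightarrow> 'a) set" where
  "robustly_wandering p q =
     {f \<in> C1. \<exists>e>0. \<forall>g\<in>C1. near e f g \<longrightarrow> g \<notin> everywhere_recurrent p q}"

lemma openin_robustly_wandering: "openin (C1_topology N \<gamma> I) (robustly_wandering p q)"
  unfolding openin_C1_topology_near
proof (intro conjI ballI)
  show "robustly_wandering p q \<subseteq> C1" unfolding robustly_wandering_def by auto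
  fix f assume "f \<in> robustly_wandering p q"
  then obtain e where e: "0 < e" "\<forall>g\<in>C1. near e f g \<longrightarrow> g \<notin> everywhere_recurrent p q"
    unfolding robustly_wandering_def by auto
  show "\<exists>e>0. \<forall>g\<in>C1. near e f g \<longrightarrow> g \<in> robustly_wandering p q"
  proof (intro exI[of _ "e / 2"] conjI ballI impI)
    fix g assume g: "g \<in> C1" "near (e / 2) f g"
    have "h \<notin> everywhere_recurrent p q" if "h \<in> C1" "near (e / 2) g h" for h
      using C1_near_triangle[OF g(2) that(2)] e(2) that(1) by simp
    then show "g \<in> robustly_wandering p q"
      unfolding robustly_wandering_def using g(1) e(1) by (auto intro!: exI[of _ "e / 2"])
  qed (use e(1) in simp)
qed

lemma traps_robustly_wandering:
  assumes "f \<in> C1" "traps f p q" "{p<..<q} \<subseteq> I"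
  shows "f \<in> robustly_wandering p q"
proof -
  obtain e where "0 < e" "\<forall>g\<in>C1. near e f g \<longrightarrow> traps g p q"
    using traps_robust[OF assms] by auto
  then show ?thesis
    unfolding robustly_wandering_def using traps_not_everywhere_recurrent[OF _ _ assms(3)] assms(1)
    by (auto intro!: exI[of _ e])
qed

theorem generic_dichotomy:
  assumes "space \<mu> = N"
  shows "\<exists>\<R>. residual_in (C1_topology N \<gamma> I) \<R> \<and>
     (\<forall>f\<in>\<R>. \<forall>A\<in>{milnor_attractor N \<mu> f, generic_limit_set N f}.
        (top_of_set N) interior_of A = {} \<or> A = N)"
proof -
  define X where "X = C1_topology N \<gamma> I"
  have topX: "topspace X = C1" unfolding X_def by (rule topspace_C1_topology)
  \<comment> \<open>Rational end points leave countably many arcs, yet every nonempty relatively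
    open subset of \<open>N\<close> contains the image of one of them.\<close>
  define Q where "Q = {(p, q). p \<in> \<rat> \<and> q \<in> \<rat> \<and> p < q \<and> {p<..<q} \<subseteq> I}"
  define W where "W z = robustly_wandering (fst z) (snd z) \<union>
      (topspace X - X closure_of robustly_wandering (fst z) (snd z))" for z
  define \<R> where "\<R> = topspace X \<inter> \<Inter> (W ` Q)"
  have "Q \<subseteq> \<rat> \<times> \<rat>" unfolding Q_def by auto
  then have "countable Q" using countable_rat countable_SIGMA countable_subset by metis
  moreover have "openin X U \<and> X closure_of U = topspace X" if "U \<in> W ` Q" for U
    using that openin_Un_exterior[OF openin_robustly_wandering] unfolding W_def X_def by auto
  ultimately have "residual_in X \<R>"
    unfolding residual_in_def \<R>_def by (intro conjI exI[of _ "W ` Q"]) auto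
  moreover have "(top_of_set N) interior_of A = {} \<or> A = N"
    if f: "f \<in> \<R>" and A: "attractor_like f A" for f A
  proof (rule disjCI)
    assume "A \<noteq> N"
    show "(top_of_set N) interior_of A = {}"
    proof (rule ccontr)
      assume ne: "(top_of_set N) interior_of A \<noteq> {}"
      have fC: "f \<in> C1" using f topX unfolding \<R>_def by simp
      have AN: "A \<subseteq> N" using A closedin_subset[of "top_of_set N" A] unfolding attractor_like_def by simp
      obtain S where S: "open S" "(top_of_set N) interior_of A = N \<inter> S"
        using openin_interior_of openin_open by metis
      have SA: "N \<inter> S \<subseteq> A" using interior_of_subset[of "top_of_set N" A] S(2) by simp
      obtain T where T: "open T" "I \<inter> \<gamma> -` S = I \<inter> T"
        using continuous_openin_preimage_gen[OF continuous_param S(1)] openin_open by metis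
      obtain t where t: "t \<in> I" "\<gamma> t \<in> S" using ne S(2) image_eq by auto
      \<comment> \<open>\<open>t\<close> may be an end point of \<open>I\<close>; density of the
        interior replaces it by a parameter with a two-sided neighbourhood.\<close>
      have "t \<in> T \<inter> closure (interior I)" using t T(2) interior_dense by auto
      then have "T \<inter> interior I \<noteq> {}" using open_Int_closure_eq_empty[OF T(1)] by auto
      then obtain u where u: "u \<in> T \<inter> interior I" by auto
      have "open (T \<inter> interior I)" using T(1) by auto
      then obtain d where d: "0 < d" "ball u d \<subseteq> T \<inter> interior I"
        using u openE by metis
      obtain p where p: "p \<in> \<rat>" "u - d < p" "p < u" using Rats_dense_in_real[of "u - d" u] d(1) by auto
      obtain q where q: "q \<in> \<rat>" "u < q" "q < u + d" using Rats_dense_in_real[of u "u + d"] d(1) by auto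
      have "{p<..<q} \<subseteq> ball u d" using p q by (auto simp: dist_real_def)
      then have sub: "{p<..<q} \<subseteq> T \<inter> interior I" using d(2) by (rule order_trans)
      then have pqI: "{p<..<q} \<subseteq> I" using interior_subset by blast
      have "\<gamma> ` {p<..<q} \<subseteq> N \<inter> S"
      proof
        fix z assume "z \<in> \<gamma> ` {p<..<q}"
        then obtain v where "v \<in> {p<..<q}" "z = \<gamma> v" by auto
        then have "v \<in> I \<inter> T" "z = \<gamma> v" using sub pqI by auto
        then show "z \<in> N \<inter> S" using T(2) param_in by auto
      qed
      then have pqA: "\<gamma> ` {p<..<q} \<subseteq> A" using SA by (rule order_trans)
      have "p < q" using p(3) q(2) by simp
      have rec: "f \<in> everywhere_recurrent p q"
        by (rule attractor_like_recurrent[OF fC A pqI pqA])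
      have "near e f f" if "0 < e" for e using that unfolding C1_near_def by simp
      \<comment> \<open>As \<open>f\<close> is near itself, recurrence keeps it out of
        \<open>robustly_wandering p q\<close>. Membership in \<open>W (p, q)\<close> then places it
        off the closure, which the approximation by traps contradicts.\<close>
      then have "f \<notin> robustly_wandering p q"
        using rec fC unfolding robustly_wandering_def by auto
      moreover have "(p, q) \<in> Q" using p(1) q(1) \<open>p < q\<close> pqI unfolding Q_def by simp
      then have "f \<in> W (p, q)" using f unfolding \<R>_def by auto
      ultimately have ext: "f \<notin> X closure_of robustly_wandering p q" unfolding W_def by simp
      have "(\<Union>n. (f ^^ n) ` \<gamma> ` {p<..<q}) \<noteq> N"
        using attractor_like_orbit[OF fC A pqA] AN \<open>A \<noteq> N\<close> by auto
      note approx = approximable_by_traps[OF rec \<open>p < q\<close> pqI _ this]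
      have "f \<in> X closure_of robustly_wandering p q"
        unfolding in_closure_of
      proof (intro conjI allI impI)
        show "f \<in> topspace X" using fC topX by simp
        fix T assume T: "f \<in> T \<and> openin X T"
        then obtain e where e: "0 < e" "\<forall>g\<in>C1. near e f g \<longrightarrow> g \<in> T"
          unfolding X_def openin_C1_topology_near by auto
        obtain g where "g \<in> C1" "near e f g" "traps g p q" using approx[OF e(1)] by auto
        then show "\<exists>g. g \<in> robustly_wandering p q \<and> g \<in> T"
          using e(2) traps_robustly_wandering[OF _ _ pqI] by auto
      qed
      then show False using ext by simp
    qed
  qed
  moreover have "f \<in> C1" if "f \<in> \<R>" for f using that topX unfolding \<R>_def by simp
  ultimately show ?thesis
    using milnor_attractor_like[OF _ assms] generic_limit_set_attractor_like
    unfolding X_def by (intro exI[of _ \<R>]) auto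
qed

end


section \<open>The segment and the circle\<close>

text \<open>On the segment \<open>f\<close> is its own lift, and adding \<open>u\<close> changes
  value and derivative by exactly \<open>u\<close> and \<open>u'\<close>, so \<open>e\<close> itself
  serves as \<open>\<kappa>\<close>. The length 1 for \<open>w\<close> is arbitrary,
  \<open>id\<close> being injective.\<close>

lemma segment_perturbable_curve:
  assumes "a < (b::real)"
  shows "perturbable_curve {a..b} id {a..b} 1"
proof -
  interpret parametrised_curve "{a..b}" "id :: real \<Rightarrow> real" "{a..b}" 1
  proof
    show "{a..b} \<subseteq> closure (interior {a..b})" using assms by simp
    show "\<exists>c. s + c = t \<and> (\<forall>x\<in>{a..b}. x + c \<in> {a..b} \<and> id (x + c) = id x)"
      if "id s = id t" for s t :: real using that by (intro exI[of _ 0]) simp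
  qed auto
  have deriv: "f \<in> C1 \<Longrightarrow> t \<in> {a..b} \<Longrightarrow>
      (f has_real_derivative param_deriv id {a..b} f t) (at t within {a..b})" for f t
    unfolding C1_maps_def param_deriv_def
    by (simp add: has_real_derivative_iff_has_vector_derivative vector_derivative_works)
  have deriv_unique: "param_deriv id {a..b} f t = d"
    if "t \<in> {a..b}" "(f has_real_derivative d) (at t within {a..b})" for f t d
    using that assms unfolding param_deriv_def has_real_derivative_iff_has_vector_derivative
    by (simp add: vector_derivative_within_closed_interval)
  show ?thesis
  proof
    fix f :: "real \<Rightarrow> real"
    assume f: "f \<in> C1"
    then have "lift f f (param_deriv id {a..b} f)"
      unfolding lift_def using deriv C1_into[OF f] by (auto simp: C1_maps_def)
    then show "\<exists>F F'. lift f F F'" by auto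
  next
    fix f F F' :: "real \<Rightarrow> real" and e :: real
    assume f: "f \<in> C1" and F: "lift f F F'" and e: "0 < e"
    have feq: "f t = F t" if "t \<in> {a..b}" for t using lift_eq[OF F that] by simp
    have fd: "param_deriv id {a..b} f t = F' t" if t: "t \<in> {a..b}" for t
    proof (rule deriv_unique[OF t])
      show "(f has_real_derivative F' t) (at t within {a..b})"
        by (rule has_field_derivative_transform_within[OF lift_DERIV[OF F t] zero_less_one t]) (simp add: feq)
    qed
    show "\<exists>\<kappa>>0. \<forall>\<tau>\<in>{a..b}. \<forall>\<delta> u u'. 0 < \<delta> \<longrightarrow> 2 * \<delta> < 1 \<longrightarrow>
        (\<forall>t\<in>{a..b}. (u has_real_derivative u' t) (at t within {a..b}) \<and> F t + u t \<in> {a..b} \<and>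
           \<bar>u t\<bar> < \<kappa> \<and> \<bar>u' t\<bar> < \<kappa> \<and> (\<delta> \<le> \<bar>t - \<tau>\<bar> \<longrightarrow> u t = 0 \<and> u' t = 0)) \<longrightarrow>
        continuous_on {a..b} u' \<longrightarrow>
        (\<exists>g\<in>C1. near e f g \<and> (\<forall>t\<in>{a..b}. \<bar>t - \<tau>\<bar> < \<delta> \<longrightarrow> g (id t) = id (F t + u t)) \<and>
           (\<forall>x\<in>{a..b} - id ` ({a..b} \<inter> ball \<tau> \<delta>). g x = f x))"
    proof (intro exI[of _ e] conjI ballI allI impI e)
      fix \<tau> \<delta> :: real and u u' :: "real \<Rightarrow> real"
      assume "\<tau> \<in> {a..b}" and cu': "continuous_on {a..b} u'" and
        u: "\<forall>t\<in>{a..b}. (u has_real_derivative u' t) (at t within {a..b}) \<and> F t + u t \<in> {a..b} \<and>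
           \<bar>u t\<bar> < e \<and> \<bar>u' t\<bar> < e \<and> (\<delta> \<le> \<bar>t - \<tau>\<bar> \<longrightarrow> u t = 0 \<and> u' t = 0)"
      define g where "g = restrict (\<lambda>t. F t + u t) {a..b}"
      have g: "g t = F t + u t" if "t \<in> {a..b}" for t using that unfolding g_def by simp
      have dg: "(g has_real_derivative F' t + u' t) (at t within {a..b})" if t: "t \<in> {a..b}" for t
      proof (rule has_field_derivative_transform_within[OF DERIV_add[OF lift_DERIV[OF F t]] zero_less_one t])
        show "(u has_real_derivative u' t) (at t within {a..b})" using u t by blast
      qed (simp add: g)
      have gd: "param_deriv id {a..b} g t = F' t + u' t" if t: "t \<in> {a..b}" for t
        by (rule deriv_unique[OF t dg[OF t]])
      have "continuous_on {a..b} (\<lambda>t. F' t + u' t)"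
        by (intro continuous_on_add cu' lift_continuous_deriv[OF F])
      moreover have "continuous_on {a..b} (param_deriv id {a..b} g) \<longleftrightarrow> continuous_on {a..b} (\<lambda>t. F' t + u' t)"
        by (rule continuous_on_cong[OF refl gd])
      ultimately have "continuous_on {a..b} (param_deriv id {a..b} g)" by simp
      moreover have "(g \<circ> id) differentiable (at t within {a..b})" if "t \<in> {a..b}" for t
        using dg[OF that] by (simp add: field_differentiable_imp_differentiable field_differentiable_def exI)
      moreover have "g \<in> {a..b} \<rightarrow>\<^sub>E {a..b}" unfolding g_def using u by auto
      ultimately have "g \<in> C1" unfolding C1_maps_def by simp
      moreover have "near e f g"
        unfolding C1_near_def using u feq g fd gd by (simp add: dist_real_def)
      ultimately show "\<exists>g\<in>C1. near e f g \<and> (\<forall>t\<in>{a..b}. \<bar>t - \<tau>\<bar> < \<delta> \<longrightarrow> g (id t) = id (F t + u t)) \<and>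
           (\<forall>x\<in>{a..b} - id ` ({a..b} \<inter> ball \<tau> \<delta>). g x = f x)"
        using g feq u by (intro bexI[of _ g]) (simp_all add: dist_real_def abs_minus_commute not_less)
    qed
  qed
qed

section \<open>The circle: angles, lifts and local perturbations\<close>

lemma cis_eq_imp_period:
  assumes "cis s = cis t"
  shows "\<exists>k::int. s = t + 2 * pi * of_int k"
proof -
  have "cis (s - t) = 1" using assms by (simp add: cis_divide[symmetric])
  then have "cos (s - t) = 1" by (metis cis.simps(1) one_complex.simps(1))
  then obtain k :: int where "s - t = of_int k * 2 * pi"
    using cos_one_2pi_int by auto
  then show ?thesis by (intro exI[of _ k]) (simp add: algebra_simps)
qed

lemma cis_add_period: "cis (t + 2 * pi * of_int k) = cis t"
  by (simp add: cis_mult[symmetric] cis_multiple_2pi)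

lemma cis_eq_short:
  assumes "cis s = cis t" "\<bar>s - t\<bar> < 2 * pi"
  shows "s = t"
proof -
  obtain k :: int where k: "s = t + 2 * pi * of_int k" using cis_eq_imp_period[OF assms(1)] by auto
  then have "2 * pi * \<bar>of_int k\<bar> < 2 * pi * 1" using assms(2) by (simp add: abs_mult)
  then have "\<bar>of_int k :: real\<bar> < 1" by (subst (asm) mult_less_cancel_left_pos) auto
  then have "k = 0" by linarith
  then show ?thesis using k by simp
qed

lemma exists_period_shift: "\<exists>k::int. a \<le> t + 2 * pi * of_int k \<and> t + 2 * pi * of_int k < a + 2 * pi"
proof -
  define k where "k = - \<lfloor>(t - a) / (2 * pi)\<rfloor>"
  have "of_int (- k) \<le> (t - a) / (2 * pi)" "(t - a) / (2 * pi) < of_int (- k) + 1"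
    unfolding k_def by linarith+
  then have "of_int (- k) * (2 * pi) \<le> t - a" "t - a < (of_int (- k) + 1) * (2 * pi)"
    by (simp_all only: pos_le_divide_eq pos_divide_less_eq pi_gt_zero zero_less_mult_iff zero_less_numeral simp_thms)
  then show ?thesis by (intro exI[of _ k]) (simp add: algebra_simps)
qed

lemma cis_Arg_sphere: "norm (z::complex) = 1 \<Longrightarrow> cis (Arg z) = z"
  by (metis rcis_cmod_Arg rcis_def mult_1 of_real_1)

lemma dist_cis_le: "dist (cis s) (cis t) \<le> \<bar>s - t\<bar>"
proof -
  have "norm (cis s - cis t) \<le> 1 * norm (s - t)"
  proof (rule differentiable_bound[of UNIV cis "\<lambda>x h. h *\<^sub>R (\<i> * cis x)"])
    show "(cis has_derivative (\<lambda>h. h *\<^sub>R (\<i> * cis x))) (at x within UNIV)" for x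
      by (auto intro!: derivative_eq_intros simp: fun_eq_iff scaleR_conv_of_real)
    show "onorm (\<lambda>h. h *\<^sub>R (\<i> * cis x)) \<le> 1" for x
      by (intro onorm_le) (simp add: norm_mult)
  qed auto
  then show ?thesis by (simp add: dist_norm)
qed

text \<open>A rotation moves the given point to 1, where \<open>Arg\<close> is continuous and
  provides a local inverse of \<open>cis\<close>.\<close>

lemma openin_cis_image:
  assumes "open S"
  shows "openin (top_of_set (sphere 0 1)) (cis ` S)"
  unfolding openin_euclidean_subtopology_iff
proof (intro conjI ballI)
  show "cis ` S \<subseteq> sphere 0 1" by auto
  fix z assume "z \<in> cis ` S"
  then obtain t where t: "t \<in> S" "z = cis t" by auto
  obtain \<epsilon> where \<epsilon>: "0 < \<epsilon>" "ball t \<epsilon> \<subseteq> S" using assms t(1) openE by metis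
  have "isCont Arg 1" by (intro continuous_at_Arg) (simp add: complex_nonpos_Reals_iff)
  then obtain d where d: "0 < d" "\<And>u. dist u 1 < d \<Longrightarrow> dist (Arg u) (Arg 1) < \<epsilon>"
    using \<epsilon>(1) unfolding continuous_at_eps_delta by metis
  show "\<exists>e>0. \<forall>x\<in>sphere 0 1. dist x z < e \<longrightarrow> x \<in> cis ` S"
  proof (intro exI[of _ d] conjI ballI impI d(1))
    fix x :: complex assume x: "x \<in> sphere 0 1" "dist x z < d"
    define u where "u = x * cis (- t)"
    have xu: "x = u * cis t" by (simp add: u_def mult.assoc cis_mult)
    have u1: "norm u = 1" using x(1) by (simp add: u_def norm_mult)
    have "dist x z = norm ((u - 1) * cis t)"
      unfolding dist_norm t(2) xu by (simp add: algebra_simps)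
    then have "dist u 1 = dist x z" by (simp add: norm_mult dist_norm)
    then have "\<bar>Arg u\<bar> < \<epsilon>" using d(2)[of u] x(2) by (simp add: dist_real_def)
    then have "t + Arg u \<in> S" using \<epsilon>(2) by (auto simp: dist_real_def subset_iff)
    moreover have "x = cis (t + Arg u)"
      using cis_Arg_sphere[OF u1] by (simp add: xu cis_mult[symmetric] mult.commute)
    ultimately show "x \<in> cis ` S" by simp
  qed
qed

lemma vector_derivative_periodic:
  fixes h :: "real \<Rightarrow> complex"
  assumes "\<And>t. h (t + c) = h t" "(h has_vector_derivative d) (at t)"
  shows "(h has_vector_derivative d) (at (t + c))"
proof -
  have "((\<lambda>s. s - c) has_vector_derivative 1) (at (t + c))"
    by (auto intro!: derivative_eq_intros)
  from vector_diff_chain_at[OF this, of h d] assms(2)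
  have "(h \<circ> (\<lambda>s. s - c) has_vector_derivative d) (at (t + c))" by simp
  moreover have "h \<circ> (\<lambda>s. s - c) = h"
    using assms(1)[of "_ - c"] by (simp add: fun_eq_iff)
  ultimately show ?thesis by simp
qed

lemma circle_parametrised_curve: "parametrised_curve (sphere (0::complex) 1) cis UNIV (2 * pi)"
proof
  show "cis ` UNIV = sphere 0 1"
  proof (intro equalityI subsetI)
    fix z :: complex assume "z \<in> sphere 0 1"
    then have "cis (Arg z) = z" by (intro cis_Arg_sphere) simp
    then show "z \<in> range cis" by (metis rangeI)
  qed auto
  show "openin (top_of_set (sphere 0 1)) (cis ` S)" if "openin (top_of_set UNIV) S" for S
    using that by (intro openin_cis_image) simp
  show "s = t" if "\<bar>s - t\<bar> < 2 * pi" "cis s = cis t" for s t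
    by (rule cis_eq_short[OF that(2,1)])
  show "\<exists>c. s + c = t \<and> (\<forall>x\<in>UNIV. x + c \<in> UNIV \<and> cis (x + c) = cis x)" if eq: "cis s = cis t" for s t
  proof -
    obtain k :: int where "t = s + 2 * pi * of_int k" using cis_eq_imp_period[OF eq[symmetric]] by auto
    then show ?thesis by (intro exI[of _ "2 * pi * of_int k"]) (simp add: cis_add_period)
  qed
  show "inj_on cis K" if K: "connected K" "cis ` K \<noteq> sphere 0 1" for K
  proof (rule linorder_inj_onI')
    fix s t assume st: "s \<in> K" "t \<in> K" "s < t"
    show "cis s \<noteq> cis t"
    proof
      assume eq: "cis s = cis t"
      \<comment> \<open>Two parameters of the same point are at least one period apart, so a
        connected set containing both contains a full period and covers the circle.\<close>
      have long: "s + 2 * pi \<le> t" using cis_eq_short[OF eq] st(3) by (cases "\<bar>s - t\<bar> < 2 * pi") auto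
      have "sphere 0 1 \<subseteq> cis ` K"
      proof
        fix z :: complex assume "z \<in> sphere 0 1"
        then have z: "cis (Arg z) = z" by (intro cis_Arg_sphere) simp
        obtain k :: int where k: "s \<le> Arg z + 2 * pi * of_int k" "Arg z + 2 * pi * of_int k < s + 2 * pi"
          using exists_period_shift[of s "Arg z"] by auto
        have "Arg z + 2 * pi * of_int k \<in> K"
          using connectedD_interval[OF K(1) st(1,2)] k long by simp
        then show "z \<in> cis ` K" using cis_add_period[of "Arg z" k] z by (intro image_eqI) simp_all
      qed
      then show False using K(2) by auto
    qed
  qed
  show "continuous_on UNIV cis" by (intro continuous_intros)
qed auto

text \<open>A nowhere vanishing function on the contractible line has a continuous logarithm. Its
  real part is 0 because the modulus is 1, and its imaginary part is the angle.\<close>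

lemma continuous_angle:
  fixes h :: "real \<Rightarrow> complex"
  assumes "\<And>t. (h has_vector_derivative h' t) (at t)" "\<And>t. norm (h t) = 1"
  shows "\<exists>F. \<forall>t. h t = cis (F t) \<and> (F has_real_derivative Im (h' t / h t)) (at t)"
proof -
  have nz: "h t \<noteq> 0" for t using assms(2)[of t] by auto
  have "continuous_on UNIV h"
    using has_vector_derivative_continuous[OF assms(1)] by (simp add: continuous_on_eq_continuous_at)
  then obtain L where L: "continuous_on UNIV L" "\<And>t. t \<in> UNIV \<Longrightarrow> h t = exp (L t)"
    by (rule continuous_logarithm_on_contractible[of UNIV h])
      (auto simp: nz convex_imp_contractible)
  have eq: "h t = cis (Im (L t))" for t
  proof -
    have "exp (Re (L t)) = 1" using assms(2)[of t] L(2)[of t] by simp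
    then show ?thesis unfolding L(2)[OF UNIV_I] exp_eq_polar[of "L t"] by simp
  qed
  have "(L has_vector_derivative h' t / h t) (at t)" for t
  proof -
    have "((\<lambda>s. h s / h t) has_vector_derivative h' t / h t) (at t)"
      by (rule has_vector_derivative_divide[OF assms(1)])
    moreover have "(Ln has_field_derivative inverse (h t / h t)) (at (h t / h t))"
      using nz[of t] by (intro has_field_derivative_Ln) (simp add: complex_nonpos_Reals_iff)
    ultimately have "(Ln \<circ> (\<lambda>s. h s / h t) has_vector_derivative h' t / h t * inverse (h t / h t)) (at t)"
      by (rule field_vector_diff_chain_at)
    then have "((\<lambda>s. Ln (h s / h t) + L t) has_vector_derivative h' t / h t) (at t)"
      using nz[of t] by (auto intro!: derivative_eq_intros simp: o_def)
    moreover have "isCont L t" using L(1) by (simp add: continuous_on_eq_continuous_at)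
    then obtain d where d: "0 < d" "\<And>s. dist s t < d \<Longrightarrow> dist (L s) (L t) < 1"
      unfolding continuous_at_eps_delta using zero_less_one by metis
    \<comment> \<open>Continuity of \<open>L\<close> keeps the imaginary part of the increment below
      1, hence below pi, so the principal logarithm recovers it. Thus \<open>L\<close> inherits the
      derivative of \<open>Ln\<close> near \<open>t\<close>.\<close>
    have "Ln (h s / h t) + L t = L s" if "dist s t < d" for s
    proof -
      have "\<bar>Im (L s - L t)\<bar> < 1"
        using d(2)[OF that] abs_Im_le_cmod[of "L s - L t"] by (simp add: dist_norm)
      then have "Ln (exp (L s - L t)) = L s - L t"
        using pi_gt3 by (intro Ln_exp) linarith+
      then show ?thesis by (simp add: L(2) exp_diff)
    qed
    ultimately show ?thesis
      using has_vector_derivative_transform_within[of _ "h' t / h t" t UNIV d L] d(1) by simp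
  qed
  then have "((\<lambda>t. Im (L t)) has_vector_derivative Im (h' t / h t)) (at t)" for t
    by (rule bounded_linear.has_vector_derivative[OF bounded_linear_Im])
  then show ?thesis
    using eq by (intro exI[of _ "\<lambda>t. Im (L t)"]) (simp add: has_real_derivative_iff_has_vector_derivative)
qed

lemma has_vector_derivative_cis:
  assumes "(F has_real_derivative d) (at t)"
  shows "((\<lambda>t. cis (F t)) has_vector_derivative d *\<^sub>R (\<i> * cis (F t))) (at t)"
proof -
  have "(cis has_vector_derivative (\<i> * cis x)) (at x)" for x
    unfolding has_vector_derivative_def
    by (auto intro!: derivative_eq_intros simp: fun_eq_iff scaleR_conv_of_real)
  from vector_diff_chain_at[OF _ this, of F d t] assms show ?thesis
    by (simp add: o_def has_real_derivative_iff_has_vector_derivative)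
qed

lemma param_deriv_cis:
  assumes "(f \<circ> cis has_vector_derivative d) (at t)"
  shows "param_deriv cis UNIV f t = d"
  using assms unfolding param_deriv_def by (simp add: vector_derivative_at)

lemma circle_derivative:
  assumes "f \<in> C1_maps (sphere 0 1) cis UNIV"
  shows "(f \<circ> cis has_vector_derivative param_deriv cis UNIV f t) (at t)"
  using assms unfolding C1_maps_def param_deriv_def by (simp add: vector_derivative_works)

lemma circle_derivative_shift:
  fixes f :: "complex \<Rightarrow> complex" and k :: int
  assumes "(f \<circ> cis has_vector_derivative d) (at t)"
  shows "(f \<circ> cis has_vector_derivative d) (at (t + 2 * pi * of_int k))"
  by (rule vector_derivative_periodic[OF _ assms]) (simp add: cis_add_period)

text \<open>The lift of a map is a continuous angle of \<open>f \<circ> cis\<close>. A perturbation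
  of the lift supported in one short window is transported to the circle by the local inverse of
  \<open>cis\<close> and glued to \<open>f\<close>.\<close>

lemma circle_perturbable_curve: "perturbable_curve (sphere (0::complex) 1) cis UNIV (2 * pi)"
proof -
  interpret parametrised_curve "sphere (0::complex) 1" cis UNIV "2 * pi"
    by (rule circle_parametrised_curve)
  show ?thesis
  proof
    fix f :: "complex \<Rightarrow> complex"
    assume f: "f \<in> C1"
    define h' where "h' = param_deriv cis UNIV f"
    have h: "(f \<circ> cis has_vector_derivative h' t) (at t)" for t
      unfolding h'_def by (rule circle_derivative[OF f])
    have n1: "norm ((f \<circ> cis) t) = 1" for t using C1_into[OF f] by auto
    obtain F where F: "\<forall>t. (f \<circ> cis) t = cis (F t) \<and> (F has_real_derivative Im (h' t / (f \<circ> cis) t)) (at t)"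
      using continuous_angle[OF h n1] by (elim exE) (rule that)
    have ch: "continuous_on UNIV (f \<circ> cis)"
      by (intro continuous_at_imp_continuous_on ballI has_vector_derivative_continuous[OF h])
    have ch': "continuous_on UNIV h'" using f unfolding C1_maps_def h'_def by simp
    have nz: "(f \<circ> cis) t \<noteq> 0" for t using n1[of t] by (metis norm_zero zero_neq_one)
    have "continuous_on UNIV (\<lambda>t. Im (h' t / (f \<circ> cis) t))"
      by (intro continuous_on_Im continuous_on_divide ch ch' ballI nz)
    moreover have "Im (h' s / (f \<circ> cis) s) = Im (h' t / (f \<circ> cis) t)" if eq: "cis s = cis t" for s t
    proof -
      obtain k :: int where k: "s = t + 2 * pi * of_int k" using cis_eq_imp_period[OF eq] by auto
      have "h' s = h' t"
        unfolding k h'_def by (rule param_deriv_cis[OF circle_derivative_shift[OF circle_derivative[OF f]]])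
      then show ?thesis using eq by (simp only: o_apply)
    qed
    ultimately have "lift f F (\<lambda>t. Im (h' t / (f \<circ> cis) t))"
      unfolding lift_def
    proof (intro conjI ballI impI UNIV_I)
      fix t
      show "f (cis t) = cis (F t)" using spec[OF F, of t] by (simp only: o_apply)
      show "(F has_real_derivative Im (h' t / (f \<circ> cis) t)) (at t)"
        using spec[OF F, of t] by (rule conjunct2)
    qed
    then show "\<exists>F F'. lift f F F'" by (intro exI)
  next
    fix f :: "complex \<Rightarrow> complex" and F F' :: "real \<Rightarrow> real" and e :: real
    assume f: "f \<in> C1" and F: "lift f F F'" and e: "0 < e"
    have "compact (F' ` {0..2 * pi})"
      by (intro compact_continuous_image continuous_on_subset[OF lift_continuous_deriv[OF F]]) simp_all
    from compact_imp_bounded[OF this] obtain M where M0: "0 < M" "\<forall>x\<in>F' ` {0..2 * pi}. norm x \<le> M"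
      unfolding bounded_pos by auto
    have M: "\<bar>F' t\<bar> \<le> M" for t
    proof -
      obtain k :: int where k: "0 \<le> t + 2 * pi * of_int k" "t + 2 * pi * of_int k < 0 + 2 * pi"
        using exists_period_shift[of 0 t] by auto
      then have "\<bar>F' (t + 2 * pi * of_int k)\<bar> \<le> M" using M0(2) by simp
      moreover have "F' (t + 2 * pi * of_int k) = F' t"
        by (rule lift_deriv_eq[OF F]) (simp_all add: cis_add_period)
      ultimately show ?thesis by simp
    qed
    \<comment> \<open>The derivative of \<open>g \<circ> cis\<close> changes by less than
      \<open>M * \<kappa> + \<kappa>\<close>: the first term comes from turning the direction, the
      second from \<open>u'\<close>.\<close>
    define \<kappa> where "\<kappa> = e / (M + 1)"
    have "(M + 1) * \<kappa> = e" using M0(1) unfolding \<kappa>_def by simp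
    then have \<kappa>_sum: "M * \<kappa> + \<kappa> = e" by (simp add: distrib_right)
    have \<kappa>: "0 < \<kappa>" using e M0(1) unfolding \<kappa>_def by simp
    then have \<kappa>_le: "\<kappa> \<le> e" using \<kappa>_sum M0(1) mult_pos_pos[OF M0(1) \<kappa>] by linarith
    have df: "(f \<circ> cis has_vector_derivative F' t *\<^sub>R (\<i> * cis (F t))) (at t)" for t
    proof -
      have "f \<circ> cis = (\<lambda>t. cis (F t))" using lift_eq[OF F] by (simp add: fun_eq_iff)
      then show ?thesis using has_vector_derivative_cis[OF lift_DERIV[OF F UNIV_I]] by simp
    qed
    show "\<exists>\<kappa>>0. \<forall>\<tau>\<in>UNIV. \<forall>\<delta> u u'. 0 < \<delta> \<longrightarrow> 2 * \<delta> < 2 * pi \<longrightarrow>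
        (\<forall>t\<in>UNIV. (u has_real_derivative u' t) (at t within UNIV) \<and> F t + u t \<in> UNIV \<and>
           \<bar>u t\<bar> < \<kappa> \<and> \<bar>u' t\<bar> < \<kappa> \<and> (\<delta> \<le> \<bar>t - \<tau>\<bar> \<longrightarrow> u t = 0 \<and> u' t = 0)) \<longrightarrow>
        continuous_on UNIV u' \<longrightarrow>
        (\<exists>g\<in>C1. near e f g \<and> (\<forall>t\<in>UNIV. \<bar>t - \<tau>\<bar> < \<delta> \<longrightarrow> g (cis t) = cis (F t + u t)) \<and>
           (\<forall>x\<in>sphere 0 1 - cis ` (UNIV \<inter> ball \<tau> \<delta>). g x = f x))"
    proof (intro exI[of _ \<kappa>] conjI ballI allI impI \<kappa>)
      fix \<tau> \<delta> :: real and u u' :: "real \<Rightarrow> real"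
      assume \<delta>: "0 < \<delta>" "2 * \<delta> < 2 * pi" and cu': "continuous_on UNIV u'" and
        u0: "\<forall>t\<in>UNIV. (u has_real_derivative u' t) (at t within UNIV) \<and> F t + u t \<in> UNIV \<and>
           \<bar>u t\<bar> < \<kappa> \<and> \<bar>u' t\<bar> < \<kappa> \<and> (\<delta> \<le> \<bar>t - \<tau>\<bar> \<longrightarrow> u t = 0 \<and> u' t = 0)"
      have u: "(u has_real_derivative u' t) (at t)" "\<bar>u t\<bar> < \<kappa>" "\<bar>u' t\<bar> < \<kappa>"
        "\<delta> \<le> \<bar>t - \<tau>\<bar> \<Longrightarrow> u t = 0" for t
        using u0 by simp_all
      have inj: "inj_on cis (ball \<tau> \<delta>)"
      proof (rule inj_onI)
        fix a b assume "a \<in> ball \<tau> \<delta>" "b \<in> ball \<tau> \<delta>" "cis a = cis b"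
        then show "a = b" using \<delta> by (intro cis_eq_short) (auto simp: dist_real_def)
      qed
      define G where "G t = F t + u t" for t
      define G' where "G' t = F' t + u' t" for t
      define g where "g z = (if z \<in> cis ` ball \<tau> \<delta> then cis (G (inv_into (ball \<tau> \<delta>) cis z)) else f z)" for z
      have g_in: "g (cis t) = cis (G t)" if "\<bar>t - \<tau>\<bar> < \<delta>" for t
        using inv_into_f_f[OF inj, of t] that unfolding g_def by (simp add: dist_real_def abs_minus_commute)
      \<comment> \<open>\<open>u\<close> is supported in a single window rather than repeated
        periodically, so \<open>G\<close> is shown to represent \<open>g\<close> only up to where
        the next copy of the support begins.\<close>
      have g_eq: "g (cis t) = cis (G t)" if t: "\<bar>t - \<tau>\<bar> < 2 * pi - \<delta>" for t
      proof (cases "\<bar>t - \<tau>\<bar> < \<delta>")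
        case False
        have "cis t \<notin> cis ` ball \<tau> \<delta>"
        proof
          assume "cis t \<in> cis ` ball \<tau> \<delta>"
          then obtain s where "s \<in> ball \<tau> \<delta>" and eq: "cis t = cis s" by blast
          then have s: "\<bar>s - \<tau>\<bar> < \<delta>" by (simp add: dist_real_def abs_minus_commute)
          have "\<bar>t - s\<bar> < 2 * pi" using s t by linarith
          then have "t = s" by (rule cis_eq_short[OF eq])
          then show False using s False by simp
        qed
        then show ?thesis using lift_eq[OF F UNIV_I] u(4)[of t] False by (simp add: g_def G_def)
      qed (rule g_in)
      define Q where "Q t = G' t *\<^sub>R (\<i> * cis (G t))" for t
      have dG: "(G has_real_derivative G' t) (at t)" for t
        unfolding G_def G'_def by (intro DERIV_add u(1) lift_DERIV[OF F UNIV_I])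
      have dg: "(g \<circ> cis has_vector_derivative Q t) (at t)" if "\<bar>t - \<tau>\<bar> < 2 * pi - \<delta>" for t
        unfolding Q_def
      proof (rule has_vector_derivative_transform_within_open[OF has_vector_derivative_cis[OF dG]])
        show "t \<in> ball \<tau> (2 * pi - \<delta>)" using that by (simp add: dist_real_def abs_minus_commute)
        show "cis (G s) = (g \<circ> cis) s" if "s \<in> ball \<tau> (2 * pi - \<delta>)" for s
          using g_eq[of s] that by (simp add: dist_real_def abs_minus_commute)
      qed simp
      \<comment> \<open>Since \<open>\<delta> < pi\<close>, the open window of half-width
        \<open>2 * pi - \<delta>\<close> is longer than a period. Every parameter has a translate
        inside it, where \<open>G\<close> represents \<open>g\<close>.\<close>
      have fundamental: "\<exists>s. \<exists>k::int. t = s + 2 * pi * of_int k \<and> \<bar>s - \<tau>\<bar> < 2 * pi - \<delta>" for t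
      proof -
        obtain k :: int where k: "\<tau> - pi \<le> t + 2 * pi * of_int k" "t + 2 * pi * of_int k < \<tau> - pi + 2 * pi"
          using exists_period_shift[of "\<tau> - pi" t] by auto
        then have "\<bar>t + 2 * pi * of_int k - \<tau>\<bar> < 2 * pi - \<delta>" using \<delta>(2) by linarith
        then show ?thesis
          by (intro exI[of _ "t + 2 * pi * of_int k"] exI[of _ "- k"]) simp
      qed
      have dgs: "(g \<circ> cis has_vector_derivative Q s) (at (s + 2 * pi * of_int k))"
        if "\<bar>s - \<tau>\<bar> < 2 * pi - \<delta>" for s and k :: int
        by (rule circle_derivative_shift[OF dg[OF that]])
      define P where "P = param_deriv cis UNIV g"
      have P: "P (s + 2 * pi * of_int k) = Q s" if "\<bar>s - \<tau>\<bar> < 2 * pi - \<delta>" for s and k :: int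
        unfolding P_def by (rule param_deriv_cis[OF dgs[OF that]])
      have contQ: "continuous_on UNIV Q"
      proof -
        have "continuous_on UNIV G" using DERIV_isCont[OF dG] by (simp add: continuous_on_eq_continuous_at)
        moreover have "continuous_on UNIV G'"
          unfolding G'_def by (intro continuous_on_add cu' lift_continuous_deriv[OF F])
        ultimately show ?thesis unfolding Q_def by (intro continuous_intros)
      qed
      \<comment> \<open>Near \<open>t\<close> the derivative \<open>P\<close> is \<open>Q\<close>
        transported by the translation by \<open>c\<close>, because the window is open.\<close>
      have "isCont P t" for t
      proof -
        obtain s and k :: int where s: "t = s + 2 * pi * of_int k" "\<bar>s - \<tau>\<bar> < 2 * pi - \<delta>"
          using fundamental[of t] by auto
        define c where "c = 2 * pi * of_int k"
        have "\<forall>\<^sub>F x in nhds s. x \<in> ball \<tau> (2 * pi - \<delta>)"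
          using s(2) by (intro eventually_nhds_in_open) (simp_all add: dist_real_def abs_minus_commute)
        then have "\<forall>\<^sub>F x in nhds s. P (x + c) = Q x"
          by (rule eventually_mono) (simp add: P c_def dist_real_def abs_minus_commute)
        moreover have "isCont Q s" using contQ by (simp add: continuous_on_eq_continuous_at)
        ultimately have "isCont (\<lambda>x. P (x + c)) s" by (subst isCont_cong)
        moreover have "isCont (\<lambda>x. x - c) t" by (intro continuous_intros)
        moreover have "t - c = s" using s(1) by (simp add: c_def)
        ultimately have "isCont (\<lambda>x. P (x - c + c)) t"
          using isCont_o2[of t "\<lambda>x. x - c" "\<lambda>x. P (x + c)"] by simp
        then show ?thesis by simp
      qed
      then have contP: "continuous_on UNIV P" by (simp add: continuous_on_eq_continuous_at)
      have "(g \<circ> cis) differentiable (at t)" for t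
      proof -
        obtain s and k :: int where s: "t = s + 2 * pi * of_int k" "\<bar>s - \<tau>\<bar> < 2 * pi - \<delta>"
          using fundamental[of t] by auto
        show ?thesis unfolding s(1) by (rule differentiableI_vector[OF dgs[OF s(2)]])
      qed
      moreover have "g \<in> sphere 0 1 \<rightarrow>\<^sub>E sphere 0 1"
      proof (rule PiE_I)
        fix z :: complex assume "z \<in> sphere 0 1"
        then have "f z \<in> sphere 0 1" by (rule funcset_mem[OF C1_into[OF f]])
        then show "g z \<in> sphere 0 1" unfolding g_def by (simp split: if_split)
      next
        fix z :: complex assume z: "z \<notin> sphere 0 1"
        then have "z \<notin> cis ` ball \<tau> \<delta>" by auto
        moreover have "f \<in> sphere 0 1 \<rightarrow>\<^sub>E sphere 0 1" using f unfolding C1_maps_def by simp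
        then have "f z = undefined" using z by (rule PiE_arb)
        ultimately show "g z = undefined" unfolding g_def by (simp only: if_False)
      qed
      ultimately have "g \<in> C1"
        unfolding C1_maps_def using contP[unfolded P_def] by (intro CollectI conjI ballI)
      moreover have "near e f g"
        unfolding C1_near_def
      proof (intro conjI ballI)
        fix z :: complex assume "z \<in> sphere 0 1"
        then have z: "cis (Arg z) = z" by (intro cis_Arg_sphere) simp
        obtain s and k :: int where s: "Arg z = s + 2 * pi * of_int k" "\<bar>s - \<tau>\<bar> < 2 * pi - \<delta>"
          using fundamental[of "Arg z"] by auto
        have zs: "z = cis s" using z s(1) cis_add_period[of s k] by simp
        have "dist (f z) (g z) \<le> \<bar>F s - G s\<bar>"
          unfolding zs g_eq[OF s(2)] lift_eq[OF F UNIV_I] by (rule dist_cis_le)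
        also have "\<dots> < e" using u(2)[of s] \<kappa>_le by (simp add: G_def)
        finally show "dist (f z) (g z) < e" .
      next
        fix t :: real
        obtain s and k :: int where s: "t = s + 2 * pi * of_int k" "\<bar>s - \<tau>\<bar> < 2 * pi - \<delta>"
          using fundamental[of t] by auto
        have pf: "param_deriv cis UNIV f t = F' s *\<^sub>R (\<i> * cis (F s))"
          unfolding s(1) by (rule param_deriv_cis[OF circle_derivative_shift[OF df]])
        have pg: "param_deriv cis UNIV g t = Q s"
          using P[OF s(2), of k] unfolding s(1) P_def .
        \<comment> \<open>Splits the change of the derivative into the turn of its direction,
          weighted by \<open>F'\<close>, and the change \<open>u'\<close> of its length.\<close>
        have "F' s *\<^sub>R (\<i> * cis (F s)) - Q s =
            F' s *\<^sub>R (\<i> * (cis (F s) - cis (G s))) - u' s *\<^sub>R (\<i> * cis (G s))"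
          by (simp add: Q_def G'_def algebra_simps)
        then have "norm (F' s *\<^sub>R (\<i> * cis (F s)) - Q s) \<le>
            norm (F' s *\<^sub>R (\<i> * (cis (F s) - cis (G s)))) + norm (u' s *\<^sub>R (\<i> * cis (G s)))"
          by (simp only: norm_triangle_ineq4)
        also have "\<dots> = \<bar>F' s\<bar> * dist (cis (F s)) (cis (G s)) + \<bar>u' s\<bar>"
          by (simp add: norm_mult dist_norm)
        also have "\<dots> \<le> M * \<kappa> + \<bar>u' s\<bar>"
        proof -
          have "dist (cis (F s)) (cis (G s)) \<le> \<kappa>"
            using dist_cis_le[of "F s" "G s"] u(2)[of s] by (simp add: G_def)
          then show ?thesis using M[of s] M0(1) by (intro add_right_mono mult_mono) auto
        qed
        also have "\<dots> < e" using u(3)[of s] \<kappa>_sum by linarith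
        finally show "dist (param_deriv cis UNIV f t) (param_deriv cis UNIV g t) < e"
          unfolding pf pg dist_norm .
      qed
      moreover have "\<forall>t\<in>UNIV. \<bar>t - \<tau>\<bar> < \<delta> \<longrightarrow> g (cis t) = cis (F t + u t)"
        using g_in unfolding G_def by simp
      moreover have "\<forall>x\<in>sphere 0 1 - cis ` (UNIV \<inter> ball \<tau> \<delta>). g x = f x"
        unfolding g_def by simp
      ultimately show "\<exists>g\<in>C1. near e f g \<and> (\<forall>t\<in>UNIV. \<bar>t - \<tau>\<bar> < \<delta> \<longrightarrow> g (cis t) = cis (F t + u t)) \<and>
           (\<forall>x\<in>sphere 0 1 - cis ` (UNIV \<inter> ball \<tau> \<delta>). g x = f x)"
        by (intro bexI[of _ g] conjI)
    qed
  qed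
qed

lemma space_lebesgue_type_measure:
  assumes "lebesgue_type_measure N \<gamma> I \<mu>"
  shows "space \<mu> = N"
proof -
  have "sets \<mu> = sets (restrict_space borel N)"
    using assms unfolding lebesgue_type_measure_def by simp
  then show ?thesis by (auto dest!: sets_eq_imp_space_eq simp: space_restrict_space)
qed

theorem mainTheorem3:
  shows "(\<forall>\<mu>. lebesgue_type_measure (sphere (0::complex) 1) cis UNIV \<mu> \<longrightarrow>
            (\<exists>\<R>. residual_in (C1_topology (sphere 0 1) cis UNIV) \<R> \<and>
              (\<forall>f\<in>\<R>. \<forall>A\<in>{milnor_attractor (sphere 0 1) \<mu> f, generic_limit_set (sphere 0 1) f}.
                  (top_of_set (sphere 0 1)) interior_of A = {} \<or> A = sphere 0 1)))
       \<and> (\<forall>(a::real) b \<mu>. a < b \<longrightarrow> lebesgue_type_measure {a..b} id {a..b} \<mu> \<longrightarrow>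
            (\<exists>\<R>. residual_in (C1_topology {a..b} id {a..b}) \<R> \<and>
              (\<forall>f\<in>\<R>. \<forall>A\<in>{milnor_attractor {a..b} \<mu> f, generic_limit_set {a..b} f}.
                  (top_of_set {a..b}) interior_of A = {} \<or> A = {a..b})))"
proof (intro conjI allI impI)
  fix \<mu> :: "complex measure"
  assume "lebesgue_type_measure (sphere 0 1) cis UNIV \<mu>"
  then show "\<exists>\<R>. residual_in (C1_topology (sphere 0 1) cis UNIV) \<R> \<and>
      (\<forall>f\<in>\<R>. \<forall>A\<in>{milnor_attractor (sphere 0 1) \<mu> f, generic_limit_set (sphere 0 1) f}.
         (top_of_set (sphere 0 1)) interior_of A = {} \<or> A = sphere 0 1)"
    by (intro perturbable_curve.generic_dichotomy[OF circle_perturbable_curve] space_lebesgue_type_measure)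
next
  fix a b :: real and \<mu>
  assume "a < b" "lebesgue_type_measure {a..b} id {a..b} \<mu>"
  then show "\<exists>\<R>. residual_in (C1_topology {a..b} id {a..b}) \<R> \<and>
      (\<forall>f\<in>\<R>. \<forall>A\<in>{milnor_attractor {a..b} \<mu> f, generic_limit_set {a..b} f}.
         (top_of_set {a..b}) interior_of A = {} \<or> A = {a..b})"
    by (intro perturbable_curve.generic_dichotomy[OF segment_perturbable_curve] space_lebesgue_type_measure)
qed

end
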